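(* Let $\mathbb{F}$ be a field of characteristic different from $2$, let $G\leq\mathrm{GL}_n(\mathbb{F})$ be a reflection group acting on $V=\mathbb{F}^n$, and let $\chi:G\to\mathbb{F}^\times$ be a linear character. Suppose $\omega_1,\dots,\omega_n$ are $\chi$-invariant $1$-forms with $$\omega_1\wedge\cdots\wedge\omega_n=c\,Q(\tilde{\mathcal A}_\chi)\,Q_\chi^{\,n-1}\,Q_{\chi\cdot\det}\,dz_1\wedge\cdots\wedge dz_n$$ for some $c\in\mathbb{F}^\times$. Then $\omega_1,\dots,\omega_n$ is a basis of the module $(\Omega^1)^G_\chi$ of $\chi$-invariant $1$-forms as a free module over $\mathbb{F}[V]^G$: $(\Omega^1)^G_\chi=\bigoplus_i\mathbb{F}[V]^G\,\omega_i$.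
   Context: $\mathbb{F}[V]=S(V^* )$; $z_1,\dots,z_n$ is a basis of $V^*$; $\Omega^1=\mathbb{F}[V]\otimes V^*$, with $G$ acting on $V^*$ by $(gf)(v)=f(g^{-1}v)$ and diagonally on forms. $(\Omega^1)^G_\chi=\{\omega\in\Omega^1: g\omega=\chi(g)\omega\ \forall g\in G\}$. A reflection is a finite-order element of $\mathrm{GL}(V)$ whose fixed space is a hyperplane; a reflection group is a finite group generated by reflections. For a hyperplane $H$ with defining linear form $l_H$, a reflection $s$ about $H$ satisfies $s(v)=v+l_H(v)\alpha_s$ (root vector $\alpha_s$); it is a transvection if $\alpha_s\in H$, diagonalizable otherwise. $\mathcal A$ is the set of reflecting hyperplanes of reflections in $G$. For $H\in\mathcal A$: $G_H$ is the pointwise stabilizer of $H$ in $G$, $K_H=\ker(\det|_{G_H})$, $e_H=|G_H:K_H|$, $G_H$ is generated by $K_H$ and a diagonalizable reflection $s_H$ of order $e_H$ ($s_H=1$ if $e_H=1$), and $b_H$ is the dimension of the span of the root vectors of transvections in $G_H$. For a linear character $\psi$ of $G$, $Q_\psi=\prod_{H\in\mathcal A}l_H^{a_H(\psi)}$, where $a_H(\psi)$ is the smallest nonnegative integer with $\psi(s_H)=\det(s_H)^{-a_H(\psi)}$. Finally $Q(\tilde{\mathcal A}_\chi)=\prod_{H\in\mathcal A,\ \chi(s_H)=1}l_H^{e_Hb_H}$. *)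

theory Defs
  imports "HOL-Analysis.Analysis" "HOL-Library.Poly_Mapping"
begin

text \<open>V = F^n is modelled as 'a^'n for a finite index type 'n (n = CARD('n)).
  A polynomial in z_1..z_n is a finitely supported map from monomials
  (finitely supported exponent vectors) to coefficients.\<close>

type_synonym ('a, 'n) mpoly = "('n \<Rightarrow>\<^sub>0 nat) \<Rightarrow>\<^sub>0 'a"

text \<open>A 1-form sum_i f_i dz_i is represented by its coefficient function i \<mapsto> f_i.\<close>
type_synonym ('a, 'n) form1 = "'n \<Rightarrow> ('a, 'n) mpoly"

definition pconst :: "'a::zero \<Rightarrow> ('a, 'n) mpoly" where
  "pconst c = Poly_Mapping.single 0 c"

definition var :: "'n \<Rightarrow> ('a::{zero,one}, 'n) mpoly" where
  "var i = Poly_Mapping.single (Poly_Mapping.single i 1) 1"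

definition lin_poly :: "'a::field ^ 'n::finite \<Rightarrow> ('a, 'n) mpoly" where
  "lin_poly l = (\<Sum>i\<in>UNIV. pconst (l $ i) * var i)"

definition psubst :: "('n::finite \<Rightarrow> ('a::field, 'n) mpoly) \<Rightarrow> ('a, 'n) mpoly \<Rightarrow> ('a, 'n) mpoly" where
  "psubst \<sigma> p = (\<Sum>m\<in>Poly_Mapping.keys p. pconst (Poly_Mapping.lookup p m) * (\<Prod>i\<in>UNIV. \<sigma> i ^ Poly_Mapping.lookup m i))"

text \<open>(g f)(v) = f(g^{-1} v): on generators, g z_i = sum_j (g^{-1})_{ij} z_j.\<close>
definition act :: "'a::field ^ 'n ^ 'n \<Rightarrow> ('a, 'n::finite) mpoly \<Rightarrow> ('a, 'n) mpoly" where
  "act g p = psubst (\<lambda>i. lin_poly (matrix_inv g $ i)) p"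

text \<open>Diagonal action on 1-forms: g(sum_i f_i dz_i) = sum_i (g f_i) (g dz_i),
  g dz_i = sum_j (g^{-1})_{ij} dz_j.\<close>
definition act_form :: "'a::field ^ 'n ^ 'n \<Rightarrow> ('a, 'n::finite) form1 \<Rightarrow> ('a, 'n) form1" where
  "act_form g \<omega> = (\<lambda>j. \<Sum>i\<in>UNIV. act g (\<omega> i) * pconst (matrix_inv g $ i $ j))"

definition invariants :: "('a::field ^ 'n ^ 'n) set \<Rightarrow> ('a, 'n::finite) mpoly set" where
  "invariants G = {f. \<forall>g\<in>G. act g f = f}"

definition chi_forms :: "('a::field ^ 'n ^ 'n) set \<Rightarrow> ('a ^ 'n ^ 'n \<Rightarrow> 'a) \<Rightarrow> ('a, 'n::finite) form1 set" where
  "chi_forms G chi = {\<omega>. \<forall>g\<in>G. act_form g \<omega> = (\<lambda>j. pconst (chi g) * \<omega> j)}"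

text \<open>omega_1 \<and> ... \<and> omega_n = (top_wedge omega) dz_1 \<and> ... \<and> dz_n.\<close>
definition top_wedge :: "('n::finite \<Rightarrow> ('a::field, 'n) form1) \<Rightarrow> ('a, 'n) mpoly" where
  "top_wedge \<omega> = det (\<chi> k j. \<omega> k j)"

definition lform :: "'a::field ^ 'n::finite \<Rightarrow> 'a ^ 'n \<Rightarrow> 'a" where
  "lform l v = (\<Sum>i\<in>UNIV. l $ i * v $ i)"

definition is_hyperplane :: "('a::field ^ 'n::finite) set \<Rightarrow> bool" where
  "is_hyperplane H \<longleftrightarrow> (\<exists>l. l \<noteq> 0 \<and> H = {v. lform l v = 0})"

definition fixspace :: "'a::field ^ 'n ^ 'n \<Rightarrow> ('a ^ 'n::finite) set" where
  "fixspace g = {v. g *v v = v}"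

definition mpow :: "'a::field ^ 'n ^ 'n \<Rightarrow> nat \<Rightarrow> 'a ^ 'n::finite ^ 'n" where
  "mpow g k = ((\<lambda>A. g ** A) ^^ k) (mat 1)"

definition is_reflection :: "'a::field ^ 'n ^ 'n::finite \<Rightarrow> bool" where
  "is_reflection g \<longleftrightarrow> invertible g \<and> (\<exists>k>0. mpow g k = mat 1) \<and> is_hyperplane (fixspace g)"

definition def_form :: "('a::field ^ 'n::finite) set \<Rightarrow> 'a ^ 'n" where
  "def_form H = (SOME l. l \<noteq> 0 \<and> H = {v. lform l v = 0})"

definition is_transvection :: "'a::field ^ 'n ^ 'n::finite \<Rightarrow> bool" where
  "is_transvection s \<longleftrightarrow> is_reflection s \<and>
     (\<exists>\<alpha>. (\<forall>v. s *v v = v + lform (def_form (fixspace s)) v *s \<alpha>) \<and> lform (def_form (fixspace s)) \<alpha> = 0)"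

definition is_diag_reflection :: "'a::field ^ 'n ^ 'n::finite \<Rightarrow> bool" where
  "is_diag_reflection s \<longleftrightarrow> is_reflection s \<and>
     (\<exists>\<alpha>. (\<forall>v. s *v v = v + lform (def_form (fixspace s)) v *s \<alpha>) \<and> lform (def_form (fixspace s)) \<alpha> \<noteq> 0)"

text \<open>Submonoid generated by S (equals the generated subgroup inside a finite group).\<close>
inductive_set mgen :: "('a::field ^ 'n ^ 'n::finite) set \<Rightarrow> ('a ^ 'n ^ 'n) set" for S where
  mgen_one: "mat 1 \<in> mgen S"
| mgen_mult: "s \<in> S \<Longrightarrow> x \<in> mgen S \<Longrightarrow> s ** x \<in> mgen S"

definition matrix_group :: "('a::field ^ 'n ^ 'n::finite) set \<Rightarrow> bool" where
  "matrix_group G \<longleftrightarrow> finite G \<and> mat 1 \<in> G \<and> (\<forall>g\<in>G. invertible g \<and> matrix_inv g \<in> G)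
     \<and> (\<forall>g\<in>G. \<forall>h\<in>G. g ** h \<in> G)"

definition reflection_group :: "('a::field ^ 'n ^ 'n::finite) set \<Rightarrow> bool" where
  "reflection_group G \<longleftrightarrow> matrix_group G \<and> G = mgen {g\<in>G. is_reflection g}"

definition lin_char :: "('a::field ^ 'n ^ 'n::finite) set \<Rightarrow> ('a ^ 'n ^ 'n \<Rightarrow> 'a) \<Rightarrow> bool" where
  "lin_char G chi \<longleftrightarrow> (\<forall>g\<in>G. chi g \<noteq> 0) \<and> (\<forall>g\<in>G. \<forall>h\<in>G. chi (g ** h) = chi g * chi h)"

definition refl_hyperplanes :: "('a::field ^ 'n ^ 'n::finite) set \<Rightarrow> ('a ^ 'n) set set" where
  "refl_hyperplanes G = {fixspace g | g. g \<in> G \<and> is_reflection g}"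

definition pstab :: "('a::field ^ 'n ^ 'n::finite) set \<Rightarrow> ('a ^ 'n) set \<Rightarrow> ('a ^ 'n ^ 'n) set" where
  "pstab G H = {g\<in>G. \<forall>v\<in>H. g *v v = v}"

definition K_H :: "('a::field ^ 'n ^ 'n::finite) set \<Rightarrow> ('a ^ 'n) set \<Rightarrow> ('a ^ 'n ^ 'n) set" where
  "K_H G H = {g\<in>pstab G H. det g = 1}"

definition e_H :: "('a::field ^ 'n ^ 'n::finite) set \<Rightarrow> ('a ^ 'n) set \<Rightarrow> nat" where
  "e_H G H = card (pstab G H) div card (K_H G H)"

definition has_order :: "'a::field ^ 'n ^ 'n::finite \<Rightarrow> nat \<Rightarrow> bool" where
  "has_order s e \<longleftrightarrow> 0 < e \<and> mpow s e = mat 1 \<and> (\<forall>k. 0 < k \<and> k < e \<longrightarrow> mpow s k \<noteq> mat 1)"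

definition s_H :: "('a::field ^ 'n ^ 'n::finite) set \<Rightarrow> ('a ^ 'n) set \<Rightarrow> 'a ^ 'n ^ 'n" where
  "s_H G H = (SOME s. s \<in> pstab G H \<and> has_order s (e_H G H)
      \<and> pstab G H = mgen (insert s (K_H G H))
      \<and> (if e_H G H = 1 then s = mat 1 else is_diag_reflection s))"

definition trans_roots :: "('a::field ^ 'n ^ 'n::finite) set \<Rightarrow> ('a ^ 'n) set \<Rightarrow> ('a ^ 'n) set" where
  "trans_roots G H = {\<alpha>. \<exists>t\<in>pstab G H. is_transvection t \<and>
       (\<forall>v. t *v v = v + lform (def_form H) v *s \<alpha>)}"

definition b_H :: "('a::field ^ 'n ^ 'n::finite) set \<Rightarrow> ('a ^ 'n) set \<Rightarrow> nat" where
  "b_H G H = vec.dim (trans_roots G H)"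

definition a_H :: "('a::field ^ 'n ^ 'n::finite) set \<Rightarrow> ('a ^ 'n) set \<Rightarrow> ('a ^ 'n ^ 'n \<Rightarrow> 'a) \<Rightarrow> nat" where
  "a_H G H psi = (LEAST a. psi (s_H G H) = inverse (det (s_H G H)) ^ a)"

definition Q_char :: "('a::field ^ 'n ^ 'n::finite) set \<Rightarrow> ('a ^ 'n ^ 'n \<Rightarrow> 'a) \<Rightarrow> ('a, 'n) mpoly" where
  "Q_char G psi = (\<Prod>H\<in>refl_hyperplanes G. lin_poly (def_form H) ^ a_H G H psi)"

definition Q_tilde :: "('a::field ^ 'n ^ 'n::finite) set \<Rightarrow> ('a ^ 'n ^ 'n \<Rightarrow> 'a) \<Rightarrow> ('a, 'n) mpoly" where
  "Q_tilde G chi = (\<Prod>H\<in>{H\<in>refl_hyperplanes G. chi (s_H G H) = 1}.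
       lin_poly (def_form H) ^ (e_H G H * b_H G H))"

end

theory Submission
  imports Defs "HOL-Computational_Algebra.Primes" "HOL-Computational_Algebra.Polynomial"
begin

text \<open>
  By Cramer's rule, a \<open>\<chi>\<close>-invariant form \<open>\<eta>\<close> times \<open>D = \<omega>\<^sub>1 \<and> \<dots> \<and> \<omega>\<^sub>n\<close> is the combination of the
  \<open>\<omega>\<^sub>k\<close> with coefficients \<open>W\<^sub>k\<close>, the wedge with \<open>\<omega>\<^sub>k\<close> replaced by \<open>\<eta>\<close>. As \<open>D\<close> and \<open>W\<^sub>k\<close> transform by
  the same character, it suffices that \<open>D\<close> divides the wedge of any \<open>n\<close> \<open>\<chi>\<close>-invariant forms, and
  since the \<open>l\<^sub>H\<close> are pairwise non-associated primes this may be checked for one hyperplane at a time.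

  Contract the forms with a basis of \<open>V\<close> made of an eigenvector \<open>\<alpha>\<close> of \<open>s\<^sub>H\<close> outside \<open>H\<close>, a basis of
  the span of the transvection roots, and further vectors of \<open>H\<close>. Every \<open>g\<close> in \<open>G\<^sub>H\<close> satisfies
  \<open>l\<^sub>H dvd g f - f\<close>, so semi-invariance under \<open>s\<^sub>H\<close> makes the contraction with \<open>\<alpha>\<close> divisible by \<open>l\<^sub>H\<close>
  to the power \<open>a\<^sub>H(\<chi> det)\<close> and those with vectors of \<open>H\<close> by \<open>l\<^sub>H\<close> to the power \<open>a\<^sub>H(\<chi>)\<close>. If
  \<open>\<chi>(s\<^sub>H) = 1\<close>, a transvection with root \<open>\<beta>\<close> moves the contraction with \<open>\<alpha>\<close> by a multiple of the one
  with \<open>\<beta>\<close>, so the latter gains one more factor and is divisible by \<open>l\<^sub>H\<close> to the power \<open>e\<^sub>H\<close>.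
\<close>

section \<open>Homomorphisms out of a monoid algebra\<close>

lemma poly_mapping_sum_single:
  "p = (\<Sum>m\<in>Poly_Mapping.keys p. Poly_Mapping.single m (Poly_Mapping.lookup p m))"
  by (rule poly_mapping_eqI)
    (auto simp: lookup_sum lookup_single when_def in_keys_iff sum.delta' sum.delta)

text \<open>The universal property of a monoid algebra: a homomorphism \<open>c\<close> on
  coefficients and a monoid homomorphism \<open>h\<close> on exponents extend to a ring
  homomorphism. It serves both for substitution and for renaming the variables.\<close>

locale monoid_algebra_lift =
  fixes c :: "'a::comm_semiring_1 \<Rightarrow> 'r::comm_semiring_1"
    and h :: "'m::comm_monoid_add \<Rightarrow> 'r"
  assumes c_0: "c 0 = 0" and c_add: "c (x + y) = c x + c y"
    and c_1: "c 1 = 1" and c_mult: "c (x * y) = c x * c y"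
    and h_0: "h 0 = 1" and h_add: "h (m + m') = h m * h m'"
begin

definition lift :: "('m \<Rightarrow>\<^sub>0 'a) \<Rightarrow> 'r" where
  "lift p = (\<Sum>m\<in>Poly_Mapping.keys p. c (Poly_Mapping.lookup p m) * h m)"

lemma lift_superset:
  assumes "finite S" "Poly_Mapping.keys p \<subseteq> S"
  shows "lift p = (\<Sum>m\<in>S. c (Poly_Mapping.lookup p m) * h m)"
  unfolding lift_def using assms
  by (intro sum.mono_neutral_left) (auto simp: in_keys_iff c_0)

lemma lift_0 [simp]: "lift 0 = 0"
  by (simp add: lift_def)

lemma lift_single: "lift (Poly_Mapping.single m x) = c x * h m"
  by (simp add: lift_def c_0)

lemma lift_1 [simp]: "lift 1 = 1"
  using lift_single[of 0 1] by (simp add: c_1 h_0)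

lemma lift_add: "lift (p + q) = lift p + lift q"
proof -
  let ?S = "Poly_Mapping.keys p \<union> Poly_Mapping.keys q"
  have "lift (p + q) = (\<Sum>m\<in>?S. c (Poly_Mapping.lookup (p + q) m) * h m)"
    by (intro lift_superset) (auto simp: keys_add)
  also have "\<dots> = (\<Sum>m\<in>?S. c (Poly_Mapping.lookup p m) * h m) + (\<Sum>m\<in>?S. c (Poly_Mapping.lookup q m) * h m)"
    by (simp add: lookup_add c_add ring_distribs sum.distrib)
  also have "\<dots> = lift p + lift q"
    by (simp add: lift_superset[of ?S])
  finally show ?thesis .
qed

lemma lift_sum: "lift (\<Sum>i\<in>I. f i) = (\<Sum>i\<in>I. lift (f i))"
  by (induction I rule: infinite_finite_induct) (auto simp: lift_add)

lemma lift_mult: "lift (p * q) = lift p * lift q"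
proof -
  let ?l = Poly_Mapping.lookup and ?k = Poly_Mapping.keys
  have "p * q = (\<Sum>m\<in>?k p. \<Sum>m'\<in>?k q. Poly_Mapping.single m (?l p m) * Poly_Mapping.single m' (?l q m'))"
    by (simp only: sum_product[symmetric] poly_mapping_sum_single[symmetric])
  also have "lift \<dots> = (\<Sum>m\<in>?k p. \<Sum>m'\<in>?k q. (c (?l p m) * h m) * (c (?l q m') * h m'))"
    by (simp add: lift_sum lift_single mult_single h_add c_mult mult_ac)
  also have "\<dots> = lift p * lift q"
    by (simp add: lift_def sum_product)
  finally show ?thesis .
qed

lemma lift_prod: "lift (\<Prod>i\<in>I. f i) = (\<Prod>i\<in>I. lift (f i))"
  by (induction I rule: infinite_finite_induct) (auto simp: lift_mult)

lemma lift_power: "lift (p ^ k) = lift p ^ k"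
  by (induction k) (auto simp: lift_mult)

end

subsection \<open>The polynomial ring\<close>

lemma pconst_0 [simp]: "pconst 0 = 0"
  and pconst_1 [simp]: "pconst 1 = 1"
  and pconst_add: "pconst (x + y) = pconst x + pconst y"
  by (simp_all add: pconst_def single_add)

lemma pconst_mult: "pconst (x * y) = pconst x * pconst y" for x y :: "'a::comm_semiring_1"
  by (simp add: pconst_def mult_single)

lemma pconst_sum: "pconst (\<Sum>i\<in>I. f i) = (\<Sum>i\<in>I. pconst (f i))" for f :: "'i \<Rightarrow> 'a::comm_semiring_1"
  by (induction I rule: infinite_finite_induct) (auto simp: pconst_add)

lemma pconst_prod: "pconst (\<Prod>i\<in>I. f i) = (\<Prod>i\<in>I. pconst (f i))" for f :: "'i \<Rightarrow> 'a::comm_semiring_1"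
  by (induction I rule: infinite_finite_induct) (auto simp: pconst_mult)

lemma pconst_diff: "pconst (x - y) = pconst x - pconst y" for x y :: "'a::comm_ring_1"
  by (simp add: pconst_def single_diff)

lemma pconst_eq_0_iff [simp]: "(pconst x :: ('a::zero, 'n) mpoly) = 0 \<longleftrightarrow> x = 0"
proof
  assume "pconst x = (0 :: ('a, 'n) mpoly)"
  then have "Poly_Mapping.lookup (pconst x :: ('a, 'n) mpoly) 0 = 0"
    by simp
  then show "x = 0"
    by (simp add: pconst_def)
qed simp

lemma pconst_inverse: "x \<noteq> 0 \<Longrightarrow> pconst x * pconst (inverse x) = 1" for x :: "'a::field"
  by (simp flip: pconst_mult)

lemma mpoly_no_zero_divisors:
  fixes p q :: "('a::field, 'n::finite) mpoly"
  assumes "p * q = 0"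
  shows "p = 0 \<or> q = 0"
proof -
  obtain idx :: "'n \<Rightarrow> nat" where idx: "inj idx"
    using finite_imp_inj_to_nat_seg[of "UNIV :: 'n set"] by auto
  define e :: "('n \<Rightarrow>\<^sub>0 nat) \<Rightarrow> (nat \<Rightarrow>\<^sub>0 nat)" where
    "e m = (\<Sum>i\<in>UNIV. Poly_Mapping.single (idx i) (Poly_Mapping.lookup m i))" for m
  have e_lookup: "Poly_Mapping.lookup (e m) (idx i) = Poly_Mapping.lookup m i" for m i
    by (simp add: e_def lookup_sum lookup_single when_def inj_eq[OF idx])
  have e_inj: "e m = e m' \<Longrightarrow> m = m'" for m m'
    by (metis e_lookup poly_mapping_eqI)
  interpret L: monoid_algebra_lift "\<lambda>x::'a. Poly_Mapping.single (0 :: nat \<Rightarrow>\<^sub>0 nat) x"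
      "\<lambda>m. Poly_Mapping.single (e m) 1"
    by unfold_locales
      (auto simp: single_add mult_single e_def lookup_add sum.distrib)
  \<comment> \<open>Every coefficient of \<open>r\<close> can be recovered from its image, hence the
    renaming is injective.\<close>
  have lookup_lift: "Poly_Mapping.lookup (L.lift r) (e m) = Poly_Mapping.lookup r m" for r m
  proof -
    have "Poly_Mapping.lookup (L.lift r) (e m)
        = (\<Sum>k\<in>Poly_Mapping.keys r. if k = m then Poly_Mapping.lookup r k else 0)"
      unfolding L.lift_def lookup_sum mult_single
      by (intro sum.cong refl) (auto simp: lookup_single when_def dest: e_inj)
    also have "\<dots> = Poly_Mapping.lookup r m"
      by (simp add: in_keys_iff)
    finally show ?thesis .
  qed
  have inj: "L.lift r = 0 \<Longrightarrow> r = 0" for r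
    using lookup_lift[of r] by (intro poly_mapping_eqI) simp
  have "L.lift p * L.lift q = 0"
    using assms by (metis L.lift_0 L.lift_mult)
  then show ?thesis
    using inj by auto
qed

lemma mpoly_mult_cancel:
  fixes p q r :: "('a::field, 'n::finite) mpoly"
  assumes "r \<noteq> 0" "r * p = r * q"
  shows "p = q"
proof -
  have "r * (p - q) = 0"
    using assms(2) by (simp add: right_diff_distrib)
  then show ?thesis
    using mpoly_no_zero_divisors[of r "p - q"] assms(1) by auto
qed

lemma mpoly_power_nonzero:
  fixes p :: "('a::field, 'n::finite) mpoly"
  shows "p \<noteq> 0 \<Longrightarrow> p ^ k \<noteq> 0"
  by (induction k) (auto dest: mpoly_no_zero_divisors)

lemma mpoly_prod_nonzero:
  fixes f :: "'i \<Rightarrow> ('a::field, 'n::finite) mpoly"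
  shows "(\<And>i. i \<in> I \<Longrightarrow> f i \<noteq> 0) \<Longrightarrow> prod f I \<noteq> 0"
  by (induction I rule: infinite_finite_induct) (auto dest: mpoly_no_zero_divisors)

lemma single_eq_monomial:
  fixes m :: "'n::finite \<Rightarrow>\<^sub>0 nat" and x :: "'a::comm_semiring_1"
  shows "Poly_Mapping.single m x = pconst x * (\<Prod>i\<in>UNIV. var i ^ Poly_Mapping.lookup m i)"
proof -
  have pow: "var i ^ k = Poly_Mapping.single (Poly_Mapping.single i k) (1::'a)" for i :: 'n and k
    by (induction k) (auto simp: var_def mult_single simp flip: single_add)
  have "(\<Prod>i\<in>I. var i ^ Poly_Mapping.lookup m i)
      = Poly_Mapping.single (\<Sum>i\<in>I. Poly_Mapping.single i (Poly_Mapping.lookup m i)) (1::'a)"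
    if "finite I" for I :: "'n set"
    using that by induction (auto simp: pow mult_single)
  moreover have "(\<Sum>i\<in>UNIV. Poly_Mapping.single i (Poly_Mapping.lookup m i)) = m"
    by (rule poly_mapping_eqI) (simp add: lookup_sum lookup_single when_def)
  ultimately show ?thesis
    by (simp add: pconst_def mult_single)
qed

interpretation psubst: monoid_algebra_lift pconst "\<lambda>m. \<Prod>i\<in>UNIV. \<sigma> i ^ Poly_Mapping.lookup m i"
  rewrites "monoid_algebra_lift.lift pconst (\<lambda>m. \<Prod>i\<in>UNIV. \<sigma> i ^ Poly_Mapping.lookup m i) = psubst \<sigma>"
  for \<sigma> :: "'n::finite \<Rightarrow> ('a::field, 'n) mpoly"
proof -
  show *: "monoid_algebra_lift pconst (\<lambda>m. \<Prod>i\<in>UNIV. \<sigma> i ^ Poly_Mapping.lookup m i)"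
    by unfold_locales (auto simp: pconst_add pconst_mult lookup_add power_add prod.distrib)
  show "monoid_algebra_lift.lift pconst (\<lambda>m. \<Prod>i\<in>UNIV. \<sigma> i ^ Poly_Mapping.lookup m i) = psubst \<sigma>"
    by (intro ext) (simp add: monoid_algebra_lift.lift_def[OF *] psubst_def)
qed

lemma psubst_pconst [simp]: "psubst \<sigma> (pconst x) = pconst x"
  using psubst.lift_single[of \<sigma> 0 x] by (simp add: pconst_def)

lemma psubst_var [simp]: "psubst \<sigma> (var i) = \<sigma> i"
  using psubst.lift_single[of \<sigma> "Poly_Mapping.single i 1" 1]
  by (simp add: var_def lookup_single when_def if_distrib cong: if_cong)

lemma mpoly_induct [case_names pconst var add mult]:
  fixes p :: "('a::field, 'n::finite) mpoly"
  assumes "\<And>x. P (pconst x)" "\<And>i. P (var i)"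
    and "\<And>p q. P p \<Longrightarrow> P q \<Longrightarrow> P (p + q)" "\<And>p q. P p \<Longrightarrow> P q \<Longrightarrow> P (p * q)"
  shows "P p"
proof -
  have P1: "P 1" and P0: "P 0"
    using assms(1)[of 1] assms(1)[of 0] by simp_all
  have pow: "P (var i ^ k)" for i k
    by (induction k) (auto intro: assms P1)
  have "P (\<Prod>i\<in>I. var i ^ Poly_Mapping.lookup m i)" if "finite I" for I and m :: "'n \<Rightarrow>\<^sub>0 nat"
    using that by induction (auto intro: assms P1 pow)
  then have mono: "P (Poly_Mapping.single m x)" for m x
    by (auto simp: single_eq_monomial intro: assms)
  have "P (\<Sum>m\<in>M. Poly_Mapping.single m (f m))" if "finite M" for M f
    using that by induction (auto intro: assms P0 mono)
  from this[of "Poly_Mapping.keys p" "Poly_Mapping.lookup p"] show ?thesis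
    by (simp only: poly_mapping_sum_single[symmetric] finite_keys)
qed

text \<open>Modulo \<open>q\<close> the substitution is the identity on constants and variables,
  which generate the ring, hence on every polynomial.\<close>

lemma dvd_psubst_diff:
  assumes "\<And>i. q dvd \<sigma> i - var i"
  shows "q dvd psubst \<sigma> p - p"
proof (induction p rule: mpoly_induct)
  case (add p r)
  have "psubst \<sigma> (p + r) - (p + r) = (psubst \<sigma> p - p) + (psubst \<sigma> r - r)"
    by (simp add: psubst.lift_add)
  with add show ?case by (metis dvd_add)
next
  case (mult p r)
  have "psubst \<sigma> (p * r) - p * r = (psubst \<sigma> p - p) * psubst \<sigma> r + p * (psubst \<sigma> r - r)"
    by (simp add: psubst.lift_mult algebra_simps)
  with mult show ?case by (metis dvd_add dvd_mult dvd_mult2)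
qed (use assms in auto)

section \<open>Linear polynomials and linear functionals\<close>

lemma lin_poly_add: "lin_poly (u + v) = lin_poly u + lin_poly v"
  by (simp add: lin_poly_def pconst_add ring_distribs sum.distrib)

lemma lin_poly_scale: "lin_poly (x *s u) = pconst x * lin_poly u"
  by (simp add: lin_poly_def pconst_mult sum_distrib_left mult.assoc)

lemma lin_poly_axis: "lin_poly (axis i 1) = (var i :: ('a::field, 'n::finite) mpoly)"
proof -
  have "pconst (axis i 1 $ j) * var j = (if j = i then var i else (0 :: ('a, 'n) mpoly))" for j
    by (auto simp: axis_def)
  then show ?thesis
    by (simp add: lin_poly_def)
qed

lemma lin_poly_0 [simp]: "lin_poly 0 = 0"
  by (simp add: lin_poly_def)

lemma lin_poly_eq_0_iff [simp]: "lin_poly l = 0 \<longleftrightarrow> l = 0"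
proof
  assume *: "lin_poly l = 0"
  have "l $ j = 0" for j
  proof -
    have single_eq: "Poly_Mapping.single i (1::nat) = Poly_Mapping.single j 1 \<longleftrightarrow> i = j" for i
      by (metis lookup_single_eq lookup_single_not_eq zero_neq_one)
    have "Poly_Mapping.lookup (lin_poly l) (Poly_Mapping.single j 1) = (\<Sum>i\<in>UNIV. if i = j then l $ i else 0)"
      unfolding lin_poly_def lookup_sum pconst_def var_def mult_single
      by (intro sum.cong refl) (simp add: lookup_single when_def single_eq del: One_nat_def)
    then show ?thesis
      using * by simp
  qed
  then show "l = 0"
    by (simp add: vec_eq_iff)
qed simp

lemma psubst_lin_poly:
  "psubst (\<lambda>i. lin_poly (A $ i)) (lin_poly l) = lin_poly (l v* A)"
proof -
  have "psubst (\<lambda>i. lin_poly (A $ i)) (lin_poly l) = (\<Sum>i\<in>UNIV. \<Sum>j\<in>UNIV. pconst (l $ i) * (pconst (A $ i $ j) * var j))"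
    by (simp add: lin_poly_def[of l] psubst.lift_sum psubst.lift_mult)
      (simp add: lin_poly_def sum_distrib_left)
  also have "\<dots> = (\<Sum>j\<in>UNIV. \<Sum>i\<in>UNIV. pconst (l $ i) * (pconst (A $ i $ j) * var j))"
    by (rule sum.swap)
  also have "\<dots> = lin_poly (l v* A)"
    by (simp add: lin_poly_def vector_matrix_mult_def pconst_sum pconst_mult sum_distrib_left mult_ac)
  finally show ?thesis .
qed

lemma lform_add: "lform l (u + v) = lform l u + lform l v"
  by (simp add: lform_def ring_distribs sum.distrib)

lemma lform_scale: "lform l (x *s u) = x * lform l u"
  by (simp add: lform_def sum_distrib_left mult_ac)

lemma lform_diff: "lform l (u - v) = lform l u - lform l v"
  by (simp add: lform_def ring_distribs sum_subtractf)

lemma lform_0: "lform l 0 = 0"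
  by (simp add: lform_def)

lemma lform_axis: "lform l (axis j 1) = l $ j"
proof -
  have "l $ i * axis j 1 $ i = (if i = j then l $ j else 0)" for i
    by (simp add: axis_def)
  then show ?thesis
    by (simp add: lform_def)
qed

lemma lform_surj:
  assumes "l \<noteq> 0"
  obtains u where "lform l u = 1"
proof -
  obtain j where j: "l $ j \<noteq> 0"
    using assms by (auto simp: vec_eq_iff)
  have "lform l (inverse (l $ j) *s axis j 1) = 1"
    using j by (simp add: lform_scale lform_axis)
  then show ?thesis ..
qed

lemma subspace_kernel_lform: "vec.subspace {v. lform l v = 0}"
  by (auto simp: vec.subspace_def lform_add lform_scale lform_0)

subsection \<open>Nonzero linear forms are prime\<close>

text \<open>\<sigma> is the pullback along the projection \<open>v - lform l v *s u\<close> onto the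
  kernel of \<open>l\<close>. It sends \<open>l\<close> to 0 and is the identity modulo
  \<open>l\<close>, so the ideal of \<open>l\<close> is the kernel of a ring endomorphism.\<close>

lemma lin_poly_dvd_witness:
  assumes "lform l u = 1"
  obtains \<sigma> where "\<And>p. lin_poly l dvd p \<longleftrightarrow> psubst \<sigma> p = 0"
    and "\<And>m. psubst \<sigma> (lin_poly m) = lin_poly (m - lform m u *s l)"
proof -
  define A where "A = (\<chi> i. axis i 1 - u $ i *s l)"
  define \<sigma> where "\<sigma> = (\<lambda>i. lin_poly (A $ i))"
  have vA: "m v* A = m - lform m u *s l" for m
  proof -
    have "(m v* A) $ j = (m - lform m u *s l) $ j" for j
    proof -
      have "m $ i * A $ i $ j = (if i = j then m $ j else 0) - m $ i * u $ i * l $ j" for i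
        by (auto simp: A_def axis_def algebra_simps)
      then show ?thesis
        by (simp add: vector_matrix_mult_def lform_def sum_subtractf sum_distrib_right)
    qed
    then show ?thesis
      by (simp add: vec_eq_iff)
  qed
  have lin: "psubst \<sigma> (lin_poly m) = lin_poly (m - lform m u *s l)" for m
    unfolding \<sigma>_def psubst_lin_poly vA ..
  have "\<sigma> i - var i = pconst (- (u $ i)) * lin_poly l" for i
  proof -
    have "\<sigma> i = lin_poly (axis i 1 + (- (u $ i)) *s l)"
      by (simp add: \<sigma>_def A_def)
    then show ?thesis
      by (simp only: lin_poly_add lin_poly_scale lin_poly_axis) simp
  qed
  then have diff: "lin_poly l dvd psubst \<sigma> p - p" for p
    by (intro dvd_psubst_diff) simp
  have "lin_poly l dvd p \<longleftrightarrow> psubst \<sigma> p = 0" for p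
  proof
    assume "lin_poly l dvd p"
    then obtain q where "p = lin_poly l * q" ..
    then show "psubst \<sigma> p = 0"
      using assms by (simp add: psubst.lift_mult lin)
  next
    assume "psubst \<sigma> p = 0"
    then show "lin_poly l dvd p"
      using diff[of p] by (simp add: dvd_minus_iff)
  qed
  with lin show ?thesis
    using that by blast
qed

text \<open>The ideal of \<open>l\<close> is the kernel of a homomorphism into a ring without zero
  divisors.\<close>

lemma lin_poly_prime:
  assumes "l \<noteq> 0" "lin_poly l dvd p * q"
  shows "lin_poly l dvd p \<or> lin_poly l dvd q"
proof -
  obtain u where "lform l u = 1"
    using assms(1) by (rule lform_surj)
  then obtain \<sigma> where "\<And>p. lin_poly l dvd p \<longleftrightarrow> psubst \<sigma> p = 0"
    by (rule lin_poly_dvd_witness) blast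
  with assms(2) show ?thesis
    using mpoly_no_zero_divisors[of "psubst \<sigma> p" "psubst \<sigma> q"] by (simp add: psubst.lift_mult)
qed

lemma lin_poly_not_dvd_1:
  assumes "l \<noteq> 0"
  shows "\<not> lin_poly l dvd 1"
proof -
  obtain u where "lform l u = 1"
    using assms(1) by (rule lform_surj)
  then obtain \<sigma> where "\<And>p. lin_poly l dvd p \<longleftrightarrow> psubst \<sigma> p = 0"
    by (rule lin_poly_dvd_witness) blast
  then show ?thesis
    by simp
qed

text \<open>The projection sends \<open>m\<close> to \<open>m - lform m u *s l\<close>; if this
  vanishes, \<open>m\<close> is a scalar multiple of \<open>l\<close>. Thus different hyperplanes
  have non-associated forms.\<close>

lemma lin_poly_dvd_lin_polyD:
  assumes "l \<noteq> 0" "m \<noteq> 0" "lin_poly l dvd lin_poly m"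
  shows "{v. lform l v = 0} = {v. lform m v = 0}"
proof -
  obtain u where "lform l u = 1"
    using assms(1) by (rule lform_surj)
  then obtain \<sigma> where "\<And>p. lin_poly l dvd p \<longleftrightarrow> psubst \<sigma> p = 0"
    "\<And>m. psubst \<sigma> (lin_poly m) = lin_poly (m - lform m u *s l)"
    by (rule lin_poly_dvd_witness) blast
  then have "m - lform m u *s l = 0"
    using assms(3) by (metis lin_poly_eq_0_iff)
  then obtain x where m: "m = x *s l"
    by (metis eq_iff_diff_eq_0)
  then have "x \<noteq> 0"
    using assms(2) by auto
  moreover have "lform m v = x * lform l v" for v
    by (simp add: m lform_def sum_distrib_left mult_ac)
  ultimately show ?thesis
    by auto
qed

lemma lin_poly_power_dvd_cancel:
  assumes "l \<noteq> 0" "\<not> lin_poly l dvd p" "lin_poly l ^ k dvd p * q"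
  shows "lin_poly l ^ k dvd q"
  using assms(3)
proof (induction k arbitrary: q)
  case (Suc k)
  have "lin_poly l dvd p * q"
    using Suc.prems by (auto intro: dvd_mult_left)
  then obtain q' where q: "q = lin_poly l * q'"
    using lin_poly_prime[OF assms(1)] assms(2) by (meson dvdE)
  from Suc.prems obtain r where "p * q = lin_poly l ^ Suc k * r" ..
  then have "lin_poly l * (p * q') = lin_poly l * (lin_poly l ^ k * r)"
    by (simp add: q mult_ac)
  then have "p * q' = lin_poly l ^ k * r"
    using mpoly_mult_cancel[of "lin_poly l"] assms(1) by simp
  then show ?case
    using Suc.IH[of q'] by (simp add: q mult_dvd_mono)
qed simp

lemma lin_poly_not_dvd_power:
  assumes "l \<noteq> 0" "\<not> lin_poly l dvd p"
  shows "\<not> lin_poly l dvd p ^ k"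
proof (induction k)
  case 0
  then show ?case
    using lin_poly_not_dvd_1[OF assms(1)] by simp
next
  case (Suc k)
  then show ?case
    using lin_poly_prime[OF assms(1), of p "p ^ k"] assms(2) by auto
qed

lemma lin_poly_not_dvd_prod:
  assumes "finite I" "l \<noteq> 0" "\<And>i. i \<in> I \<Longrightarrow> \<not> lin_poly l dvd f i"
  shows "\<not> lin_poly l dvd (\<Prod>i\<in>I. f i)"
  using assms(1,3)
proof (induction I rule: finite_induct)
  case empty
  then show ?case
    using lin_poly_not_dvd_1[OF assms(2)] by simp
next
  case (insert i I)
  then show ?case
    using lin_poly_prime[OF assms(2), of "f i" "\<Prod>i\<in>I. f i"] by auto
qed

text \<open>The prime powers are absorbed one at a time: a new prime does not divide the product
  collected so far, so its power must divide the remaining quotient of \<open>w\<close>.\<close>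

lemma prod_lin_poly_power_dvd:
  fixes l :: "'i \<Rightarrow> 'a::field ^ 'n::finite"
  assumes "finite I" and l: "\<And>i. i \<in> I \<Longrightarrow> l i \<noteq> 0"
    and dvd: "\<And>i. i \<in> I \<Longrightarrow> lin_poly (l i) ^ k i dvd w"
    and distinct: "\<And>i j. i \<in> I \<Longrightarrow> j \<in> I \<Longrightarrow> lin_poly (l i) dvd lin_poly (l j) \<Longrightarrow> i = j"
  shows "(\<Prod>i\<in>I. lin_poly (l i) ^ k i) dvd w"
proof -
  have "(\<Prod>i\<in>J. lin_poly (l i) ^ k i) dvd w" if "finite J" "J \<subseteq> I" for J
    using that
  proof (induction J rule: finite_induct)
    case (insert i J)
    let ?P = "\<Prod>i\<in>J. lin_poly (l i) ^ k i"
    from insert obtain q where q: "w = ?P * q"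
      by (auto elim: dvdE)
    have "\<not> lin_poly (l i) dvd ?P"
      using insert.hyps insert.prems l distinct
      by (intro lin_poly_not_dvd_prod lin_poly_not_dvd_power) auto
    moreover have "lin_poly (l i) ^ k i dvd ?P * q"
      using dvd[of i] insert.prems unfolding q by blast
    ultimately have "lin_poly (l i) ^ k i dvd q"
      using lin_poly_power_dvd_cancel[of "l i"] l insert.prems by blast
    then have "?P * lin_poly (l i) ^ k i dvd w"
      unfolding q by (intro mult_dvd_mono) auto
    then show ?case
      using insert.hyps by (simp add: mult.commute)
  qed simp
  then show ?thesis
    using assms(1) by blast
qed

subsection \<open>Determinants over commutative rings\<close>

text \<open>The adjugate matrix. Replacing a row by a unit vector, instead of deleting a row and a
  column, keeps the index type fixed.\<close>

definition cofactors :: "'r::comm_ring_1 ^ 'n::finite ^ 'n \<Rightarrow> 'r ^ 'n ^ 'n" where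
  "cofactors A = (\<chi> j k. det (\<chi> i. if i = k then axis j 1 else A $ i))"

lemma det_replace_row:
  "det (\<chi> i. if i = k then y else A $ i) = (\<Sum>j\<in>UNIV. y $ j * cofactors A $ j $ k)"
proof -
  have y: "y = (\<Sum>j\<in>UNIV. y $ j *s axis j 1)"
    by (simp add: basis_expansion)
  have "det (\<chi> i. if i = k then y else A $ i)
      = det (\<chi> i. if i = k then (\<Sum>j\<in>UNIV. y $ j *s axis j 1) else A $ i)"
    by (subst y) (rule refl)
  also have "\<dots> = (\<Sum>j\<in>UNIV. det (\<chi> i. if i = k then y $ j *s axis j 1 else A $ i))"
    by (rule det_linear_row_sum) simp
  also have "\<dots> = (\<Sum>j\<in>UNIV. y $ j * cofactors A $ j $ k)"
    by (simp add: cofactors_def det_row_mul)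
  finally show ?thesis .
qed

text \<open>Entry \<open>(i, k)\<close> is the determinant of \<open>A\<close> with row
  \<open>k\<close> overwritten by row \<open>i\<close>, which has two equal rows unless
  \<open>i = k\<close>.\<close>

lemma matrix_mult_cofactors: "A ** cofactors A = mat (det A)"
proof -
  have "(A ** cofactors A) $ i $ k = mat (det A) $ i $ k" for i k
  proof -
    have "(A ** cofactors A) $ i $ k = det (\<chi> m. if m = k then A $ i else A $ m)"
      by (simp add: det_replace_row matrix_matrix_mult_def)
    also have "\<dots> = (if i = k then det A else 0)"
    proof (cases "i = k")
      case True
      then have "(\<chi> m. if m = k then A $ i else A $ m) = A"
        by (simp add: vec_eq_iff)
      with True show ?thesis by simp
    next
      case False
      then show ?thesis
        by (simp add: det_identical_rows[of i k] row_def)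
    qed
    finally show ?thesis
      by (simp add: mat_def)
  qed
  then show ?thesis
    by (simp add: vec_eq_iff)
qed

lemma mat_mult_left: "(mat c ** A) $ i $ j = c * A $ i $ j" for A :: "'r::comm_ring_1 ^ 'n::finite ^ 'n"
proof -
  have "mat c $ i $ k * A $ k $ j = (if k = i then c * A $ i $ j else 0)" for k
    by (auto simp: mat_def)
  then show ?thesis
    by (simp add: matrix_matrix_mult_def)
qed

lemma mat_mult_right: "(A ** mat c) $ i $ j = c * A $ i $ j" for A :: "'r::comm_ring_1 ^ 'n::finite ^ 'n"
proof -
  have "A $ i $ k * mat c $ k $ j = (if k = j then c * A $ i $ j else 0)" for k
    by (auto simp: mat_def)
  then show ?thesis
    by (simp add: matrix_matrix_mult_def)
qed

lemma det_mat: "det (mat c :: 'r::comm_ring_1 ^ 'n ^ 'n::finite) = c ^ CARD('n)"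
  by (subst det_diagonal) (auto simp: mat_def)

text \<open>The other order follows by cancellation. With \<open>C\<close> the adjugate,
  \<open>C ** A ** C\<close> equals \<open>det A\<close> times \<open>C\<close>; multiplying on the
  right by the adjugate of \<open>C\<close> turns the last \<open>C\<close> into the scalar
  \<open>det C\<close>, nonzero because \<open>det A * det C\<close> is a power of
  \<open>det A\<close>.\<close>

lemma cofactors_matrix_mult:
  fixes A :: "('a::field, 'n::finite) mpoly ^ 'm::finite ^ 'm"
  assumes "det A \<noteq> 0"
  shows "cofactors A ** A = mat (det A)"
proof -
  let ?C = "cofactors A"
  have "det A * det ?C = det A ^ CARD('m)"
    by (metis det_mul det_mat matrix_mult_cofactors)
  then have C: "det ?C \<noteq> 0"
    using mpoly_power_nonzero[OF assms, of "CARD('m)"] by auto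
  have "?C ** A ** ?C = ?C ** mat (det A)"
    by (simp only: matrix_mul_assoc[symmetric] matrix_mult_cofactors)
  also have "\<dots> = mat (det A) ** ?C"
    by (simp add: vec_eq_iff mat_mult_left mat_mult_right)
  finally have "?C ** A ** (?C ** cofactors ?C) = mat (det A) ** (?C ** cofactors ?C)"
    by (simp only: matrix_mul_assoc)
  then have "det ?C * (?C ** A) $ i $ j = det ?C * mat (det A) $ i $ j" for i j
    by (simp only: matrix_mult_cofactors mat_mult_right[symmetric])
  then have "(?C ** A) $ i $ j = mat (det A) $ i $ j" for i j
    using mpoly_mult_cancel[OF C] by blast
  then show ?thesis
    by (simp add: vec_eq_iff)
qed

text \<open>Each term of the Leibniz expansion takes exactly one entry from every column.\<close>

lemma det_dvd_of_columns:
  fixes M :: "'r::comm_ring_1 ^ 'n::finite ^ 'n"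
  assumes "\<And>i j. x ^ k j dvd M $ i $ j"
  shows "x ^ (\<Sum>j\<in>UNIV. k j) dvd det M"
  unfolding det_def
proof (intro dvd_sum dvd_mult)
  fix p assume "p \<in> {p. p permutes (UNIV :: 'n set)}"
  then have "(\<Sum>j\<in>UNIV. k j) = (\<Sum>i\<in>UNIV. k (p i))"
    using sum.permute[of p UNIV k] by (simp add: comp_def)
  then have "x ^ (\<Sum>j\<in>UNIV. k j) = (\<Prod>i\<in>UNIV. x ^ k (p i))"
    by (simp add: power_sum)
  also have "\<dots> dvd (\<Prod>i\<in>UNIV. M $ i $ p i)"
    by (intro prod_dvd_prod) (auto intro: assms)
  finally show "x ^ (\<Sum>j\<in>UNIV. k j) dvd (\<Prod>i\<in>UNIV. M $ i $ p i)" .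
qed

lemma det_pconst: "det (\<chi> i j. pconst (A $ i $ j)) = pconst (det A)"
  for A :: "'a::field ^ 'n::finite ^ 'n"
  by (simp add: det_def pconst_sum pconst_mult pconst_prod) (simp add: pconst_def)

text \<open>The signs in the Leibniz expansion appear as \<open>of_int\<close>; this lets
  substitution pass through \<open>det\<close>.\<close>

lemma psubst_of_int [simp]: "psubst \<sigma> (of_int k) = of_int k"
  using psubst_pconst[of \<sigma> "of_int k"] by (simp add: pconst_def)

lemma psubst_det: "psubst \<sigma> (det M) = det (\<chi> i j. psubst \<sigma> (M $ i $ j))"
  by (simp add: det_def psubst.lift_sum psubst.lift_mult psubst.lift_prod)

section \<open>The action of matrices on polynomials\<close>

lemma act_mult: "act g (p * q) = act g p * act g q"
  and act_sum: "act g (\<Sum>i\<in>I. f i) = (\<Sum>i\<in>I. act g (f i))"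
  and act_power: "act g (p ^ k) = act g p ^ k"
  and act_pconst [simp]: "act g (pconst x) = pconst x"
  and act_det: "act g (det M) = det (\<chi> i j. act g (M $ i $ j))"
  by (simp_all add: act_def psubst.lift_mult psubst.lift_sum psubst.lift_power psubst_det)

lemma matrix_inv_left: "invertible M \<Longrightarrow> matrix_inv M ** M = mat 1"
  and matrix_inv_right: "invertible M \<Longrightarrow> M ** matrix_inv M = mat 1"
  unfolding invertible_def matrix_inv_def
  by (metis (mono_tags, lifting) someI_ex)+

subsection \<open>Matrices fixing a hyperplane pointwise\<close>

text \<open>One notion for transvections, diagonalizable reflections and the identity (root \<alpha>
  = 0), relative to a fixed form \<open>l\<close>.\<close>

definition shear :: "'a::field ^ 'n::finite \<Rightarrow> 'a ^ 'n \<Rightarrow> 'a ^ 'n ^ 'n \<Rightarrow> bool" where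
  "shear l \<alpha> g \<longleftrightarrow> (\<forall>v. g *v v = v + lform l v *s \<alpha>)"

lemma shear_row:
  assumes "shear l \<alpha> g"
  shows "g $ i = axis i 1 + \<alpha> $ i *s l"
proof -
  have "g $ i $ j = (axis i 1 + \<alpha> $ i *s l) $ j" for j
  proof -
    have "g $ i $ k * axis j 1 $ k = (if k = j then g $ i $ j else 0)" for k
      by (simp add: axis_def)
    then have "(g *v axis j 1) $ i = g $ i $ j"
      by (simp add: matrix_vector_mult_def)
    then show ?thesis
      using assms lform_axis[of l j] by (auto simp: shear_def axis_def mult.commute)
  qed
  then show ?thesis
    by (simp add: vec_eq_iff)
qed

lemma shear_root_eigenvector:
  "shear l \<alpha> g \<Longrightarrow> g *v \<alpha> = (1 + lform l \<alpha>) *s \<alpha>"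
  by (simp add: shear_def vector_sadd_rdistrib)

text \<open>The root \<alpha> is an eigenvector for this value. If the value were 0, then \<alpha>
  would lie in the kernel of \<open>g\<close>, so \<alpha> = 0, and the value would be 1.\<close>

lemma shear_eigenvalue_nonzero:
  assumes "shear l \<alpha> g" "invertible g"
  shows "1 + lform l \<alpha> \<noteq> 0"
proof
  assume *: "1 + lform l \<alpha> = 0"
  then have "g *v \<alpha> = 0"
    using shear_root_eigenvector[OF assms(1)] by simp
  then have "\<alpha> = 0"
    by (metis assms(2) invertible_def matrix_left_invertible_ker)
  with * show False
    by (simp add: lform_def)
qed

lemma shear_matrix_inv:
  assumes "shear l \<alpha> g" "invertible g"
  shows "shear l (- inverse (1 + lform l \<alpha>) *s \<alpha>) (matrix_inv g)"
  unfolding shear_def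
proof
  fix v
  define w where "w = matrix_inv g *v v"
  have "g *v w = v"
    by (simp add: w_def matrix_vector_mul_assoc matrix_inv_right assms(2))
  then have v: "v = w + lform l w *s \<alpha>"
    using assms(1) by (simp add: shear_def)
  then have "lform l v = (1 + lform l \<alpha>) * lform l w"
    by (simp add: lform_add lform_scale algebra_simps)
  then have "lform l w = inverse (1 + lform l \<alpha>) * lform l v"
    using shear_eigenvalue_nonzero[OF assms] by simp
  then have "lform l v *s (- inverse (1 + lform l \<alpha>) *s \<alpha>) = - (lform l w *s \<alpha>)"
    by (simp add: vec_eq_iff mult_ac)
  then show "matrix_inv g *v v = v + lform l v *s (- inverse (1 + lform l \<alpha>) *s \<alpha>)"
    unfolding w_def[symmetric] using v by (metis add_diff_cancel diff_conv_add_uminus)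
qed

text \<open>The inverse of a shear is a shear with the same form, so every variable is moved by a
  multiple of \<open>l\<close>, and then so is every polynomial.\<close>

lemma lin_poly_dvd_act_diff:
  assumes "shear l \<alpha> g" "invertible g"
  shows "lin_poly l dvd act g p - p"
proof -
  let ?\<beta> = "- inverse (1 + lform l \<alpha>) *s \<alpha>"
  have "lin_poly (matrix_inv g $ i) - var i = pconst (?\<beta> $ i) * lin_poly l" for i
    unfolding shear_row[OF shear_matrix_inv[OF assms]] lin_poly_add lin_poly_scale lin_poly_axis
    by simp
  then show ?thesis
    unfolding act_def by (intro dvd_psubst_diff) simp
qed

lemma act_lin_poly_shear:
  assumes "shear l \<alpha> g" "invertible g"
  shows "act g (lin_poly l) = pconst (inverse (1 + lform l \<alpha>)) * lin_poly l"
proof -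
  let ?\<beta> = "- inverse (1 + lform l \<alpha>) *s \<alpha>"
  have "l v* matrix_inv g = (1 + lform l ?\<beta>) *s l"
  proof -
    have "(l v* matrix_inv g) $ j = ((1 + lform l ?\<beta>) *s l) $ j" for j
    proof -
      have "l $ i * axis i 1 $ j = (if i = j then l $ j else 0)" for i
        by (simp add: axis_def)
      then show ?thesis
        unfolding vector_matrix_mult_def shear_row[OF shear_matrix_inv[OF assms]]
        by (simp add: lform_def ring_distribs sum.distrib sum_subtractf sum_distrib_left sum_distrib_right sum_negf mult_ac)
    qed
    then show ?thesis
      by (simp add: vec_eq_iff)
  qed
  moreover have "1 + lform l ?\<beta> = inverse (1 + lform l \<alpha>)"
    using shear_eigenvalue_nonzero[OF assms] unfolding lform_scale by (simp add: field_simps)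
  ultimately show ?thesis
    by (simp only: act_def psubst_lin_poly lin_poly_scale)
qed

text \<open>For \<open>a > 0\<close>, \<open>l\<close> divides \<open>act g f - f\<close>, a nonzero
  constant multiple of \<open>f\<close>. Since \<open>l\<close> has eigenvalue \<nu>, the quotient
  of \<open>f\<close> by \<open>l\<close> is semi-invariant with exponent \<open>a - 1\<close>. The
  condition on the smaller exponents keeps the constant nonzero at each stage.\<close>

lemma semi_invariant_dvd:
  assumes "l \<noteq> 0" "shear l \<alpha> g" "invertible g" and \<nu>: "\<nu> = inverse (1 + lform l \<alpha>)"
    and "act g f = pconst (\<nu> ^ a) * f" "\<And>b. b < a \<Longrightarrow> \<nu> ^ b \<noteq> \<nu> ^ a"
  shows "lin_poly l ^ a dvd f"
  using assms(5,6)
proof (induction a arbitrary: f)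
  case (Suc a)
  have \<nu>0: "\<nu> \<noteq> 0"
    using shear_eigenvalue_nonzero[OF assms(2,3)] by (simp add: \<nu>)
  have "\<nu> ^ Suc a - 1 \<noteq> 0"
    using Suc.prems(2)[of 0] by auto
  then have unit: "pconst (\<nu> ^ Suc a - 1) * pconst (inverse (\<nu> ^ Suc a - 1)) = 1"
    by (rule pconst_inverse)
  have "act g f - f = pconst (\<nu> ^ Suc a - 1) * f"
    by (simp only: Suc.prems(1) pconst_diff pconst_1 left_diff_distrib mult_1)
  then have "lin_poly l dvd (pconst (\<nu> ^ Suc a - 1) * f) * pconst (inverse (\<nu> ^ Suc a - 1))"
    using lin_poly_dvd_act_diff[OF assms(2,3), of f] by simp
  also have "\<dots> = f"
    by (metis (no_types) unit mult.commute mult.left_commute mult_1)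
  finally obtain f' where f: "f = lin_poly l * f'" ..
  have "pconst \<nu> * lin_poly l * act g f' = pconst \<nu> * lin_poly l * (pconst (\<nu> ^ a) * f')"
    using Suc.prems(1)
    by (simp add: f act_mult act_lin_poly_shear[OF assms(2,3)] pconst_mult mult_ac flip: \<nu>)
  moreover have "pconst \<nu> * lin_poly l \<noteq> 0"
    using mpoly_no_zero_divisors[of "pconst \<nu>" "lin_poly l"] \<nu>0 assms(1) by auto
  ultimately have "act g f' = pconst (\<nu> ^ a) * f'"
    using mpoly_mult_cancel by blast
  moreover have "\<nu> ^ b \<noteq> \<nu> ^ a" if "b < a" for b
    using Suc.prems(2)[of "Suc b"] that by auto
  ultimately have "lin_poly l ^ a dvd f'"
    by (rule Suc.IH)
  then show ?case
    by (simp add: f mult_dvd_mono)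
qed simp

text \<open>The vector \<open>v - lform l v *s u\<close> lies in the hyperplane, so \<open>g\<close>
  fixes it; the root is the displacement of \<open>u\<close>.\<close>

lemma pstab_shear:
  assumes "g \<in> pstab G {v. lform l v = 0}" "lform l u = 1"
  shows "shear l (g *v u - u) g"
  unfolding shear_def
proof
  fix v
  have "v - lform l v *s u \<in> {v. lform l v = 0}"
    using assms(2) by (simp add: lform_diff lform_scale)
  then have "g *v (v - lform l v *s u) = v - lform l v *s u"
    using assms(1) by (auto simp: pstab_def)
  then have "g *v v - lform l v *s (g *v u) = v - lform l v *s u"
    by (simp only: vec.diff vec.scale)
  then have "g *v v = v - lform l v *s u + lform l v *s (g *v u)"
    by (simp only: diff_eq_eq)
  then show "g *v v = v + lform l v *s (g *v u - u)"
    by (simp only: vector_ssub_ldistrib) simp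
qed

text \<open>Extend \<open>B\<close> to a basis of the hyperplane, add \<alpha>, and index the result
  by \<open>'n\<close>, which has the right cardinality. The nonzero determinant expresses that the
  \<open>v j\<close> form a basis.\<close>

lemma hyperplane_adapted_basis:
  fixes l :: "'a::field ^ 'n::finite"
  assumes B: "B \<subseteq> {v. lform l v = 0}" "vec.independent B" and \<alpha>: "lform l \<alpha> \<noteq> 0"
  obtains v :: "'n \<Rightarrow> 'a ^ 'n" and k where "v k = \<alpha>" "\<And>j. j \<noteq> k \<Longrightarrow> lform l (v j) = 0"
    "inj v" "B \<subseteq> v ` (- {k})" "det (\<chi> i j. v j $ i) \<noteq> 0"
proof -
  let ?H = "{v. lform l v = 0}"
  obtain C where C: "B \<subseteq> C" "C \<subseteq> ?H" "vec.independent C" "?H \<subseteq> vec.span C"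
    by (rule vec.maximal_independent_subset_extend[OF B])
  have "vec.span C \<subseteq> ?H"
    using C(2) subspace_kernel_lform by (rule vec.span_minimal)
  then have \<alpha>C: "\<alpha> \<notin> vec.span C"
    using \<alpha> by auto
  then have ind: "vec.independent (insert \<alpha> C)"
    using C(3) by (rule vec.independent_insertI)
  have span: "vec.span (insert \<alpha> C) = UNIV"
  proof (intro equalityI subsetI)
    fix x
    let ?c = "lform l x / lform l \<alpha>"
    have "x - ?c *s \<alpha> \<in> ?H"
      using \<alpha> by (simp add: lform_diff lform_scale)
    then have "x - ?c *s \<alpha> \<in> vec.span C"
      using C(4) by blast
    then show "x \<in> vec.span (insert \<alpha> C)"
      unfolding vec.span_insert by blast
  qed simp
  have fin: "finite (insert \<alpha> C)"
    using ind by (rule vec.finiteI_independent)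
  have "card (insert \<alpha> C) = vec.dim (UNIV :: ('a ^ 'n) set)"
    by (rule vec.basis_card_eq_dim) (simp_all add: span ind)
  also have "\<dots> = CARD('n)"
    by (simp add: card_cart_basis)
  finally obtain v where v: "bij_betw v (UNIV :: 'n set) (insert \<alpha> C)"
    using finite_same_card_bij[OF finite fin] by (metis (no_types))
  then have rng: "range v = insert \<alpha> C" and inj: "inj v"
    by (simp_all add: bij_betw_def)
  then obtain k where k: "v k = \<alpha>"
    by (metis rangeE insertI1)
  have "columns (\<chi> i j. v j $ i) = range v"
    by (auto simp: columns_def column_def)
  then have "det (\<chi> i j. v j $ i) \<noteq> 0"
    using matrix_right_invertible_span_columns[of "\<chi> i j. v j $ i"] span
    by (simp add: rng invertible_right_inverse flip: invertible_det_nz)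
  moreover note inj
  moreover have vC: "v j \<in> C" if "j \<noteq> k" for j
  proof -
    have "v j \<in> insert \<alpha> C"
      using rng by blast
    moreover have "v j \<noteq> \<alpha>"
      using injD[OF inj, of j k] k that by auto
    ultimately show ?thesis by simp
  qed
  moreover have "B \<subseteq> v ` (- {k})"
  proof
    fix x assume "x \<in> B"
    then have "x \<in> insert \<alpha> C" "x \<noteq> \<alpha>"
      using C(1) \<alpha>C vec.span_base[of \<alpha> C] by auto
    then obtain j where "x = v j"
      by (metis rangeE rng)
    then show "x \<in> v ` (- {k})"
      using \<open>x \<noteq> \<alpha>\<close> k by auto
  qed
  ultimately show ?thesis
    using k C(2) by (intro that[of v k]) blast+
qed

text \<open>In a basis consisting of \<open>u\<close> and vectors of the hyperplane,
  \<open>g\<close> changes only the column of \<open>u\<close>, to \<open>u + \<alpha>\<close>.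
  Cramer's lemma gives the determinant as the \<open>u\<close>-coordinate of this vector, which
  \<open>l\<close> reads off because \<open>lform l u = 1\<close>.\<close>

lemma det_shear:
  fixes g :: "'a::field ^ 'n ^ 'n::finite"
  assumes "shear l \<alpha> g" "l \<noteq> 0"
  shows "det g = 1 + lform l \<alpha>"
proof -
  obtain u where u: "lform l u = 1"
    using assms(2) by (rule lform_surj)
  obtain v :: "'n \<Rightarrow> 'a ^ 'n" and k where v: "v k = u" "\<And>j. j \<noteq> k \<Longrightarrow> lform l (v j) = 0"
      and det: "det (\<chi> i j. v j $ i) \<noteq> 0"
    using hyperplane_adapted_basis[of "{}" l u] u vec.independent_empty
    by (metis empty_subsetI zero_neq_one)
  define P where "P = (\<chi> i j. v j $ i)"
  have Pv: "P *v x = (\<Sum>j\<in>UNIV. x $ j *s v j)" for x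
    by (simp add: P_def matrix_mult_sum column_def)
  have "surj ((*v) P)"
    using det by (metis P_def invertible_det_nz invertible_right_inverse matrix_right_invertible_surjective)
  then obtain x where x: "P *v x = u + \<alpha>"
    by (metis surjD)
  have lsum: "lform l (\<Sum>j\<in>J. f j) = (\<Sum>j\<in>J. lform l (f j))" for f and J :: "'n set"
    by (induction J rule: infinite_finite_induct) (auto simp: lform_add lform_0)
  have "x $ j * lform l (v j) = (if j = k then x $ k else 0)" for j
    using v u by auto
  then have "lform l (P *v x) = x $ k"
    unfolding Pv lsum lform_scale by simp
  then have xk: "x $ k = 1 + lform l \<alpha>"
    by (simp add: x lform_add u)
  have gP: "(g ** P) $ i $ j = (g *v v j) $ i" for i j
    by (simp add: P_def matrix_matrix_mult_def matrix_vector_mult_def)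
  have "g ** P = (\<chi> i j. if j = k then (P *v x) $ i else P $ i $ j)"
  proof -
    have "(g *v v j) $ i = (if j = k then (P *v x) $ i else P $ i $ j)" for i j
    proof (cases "j = k")
      case True
      then show ?thesis
        using assms(1) v(1) u by (simp add: shear_def x)
    next
      case False
      then show ?thesis
        using assms(1) v(2)[OF False] by (simp add: shear_def P_def)
    qed
    then show ?thesis
      by (simp add: vec_eq_iff gP)
  qed
  then have "det g * det P = (1 + lform l \<alpha>) * det P"
    using cramer_lemma[of k P x] by (metis xk det_mul)
  then show ?thesis
    using det by (simp add: P_def)
qed

subsection \<open>Contraction of 1-forms with vectors\<close>

text \<open>Pairing with the constant vector field \<open>v\<close>. It allows a basis adapted to a
  hyperplane without changing the polynomial variables.\<close>

definition contract :: "('a::field, 'n::finite) form1 \<Rightarrow> 'a ^ 'n \<Rightarrow> ('a, 'n) mpoly" where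
  "contract \<eta> v = (\<Sum>i\<in>UNIV. \<eta> i * pconst (v $ i))"

lemma contract_add: "contract \<eta> (u + v) = contract \<eta> u + contract \<eta> v"
  by (simp add: contract_def pconst_add ring_distribs sum.distrib)

lemma contract_scale: "contract \<eta> (x *s v) = pconst x * contract \<eta> v"
  by (simp add: contract_def pconst_mult sum_distrib_left mult_ac)

text \<open>The pairing is equivariant: acting on the value amounts to acting on both the form and
  the vector.\<close>

lemma act_contract:
  assumes "\<eta> \<in> chi_forms G chi" "g \<in> G" "invertible g"
  shows "act g (contract \<eta> u) = pconst (chi g) * contract \<eta> (g *v u)"
proof -
  let ?B = "matrix_inv g"
  obtain w where w: "w = g *v u"
    by simp
  have *: "(\<Sum>i\<in>UNIV. act g (\<eta> i) * pconst (?B $ i $ j)) = pconst (chi g) * \<eta> j" for j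
    using assms(1,2) by (auto simp: chi_forms_def act_form_def fun_eq_iff)
  have u: "u = ?B *v w"
    by (simp add: w matrix_vector_mul_assoc matrix_inv_left assms(3))
  have "u $ i = (\<Sum>j\<in>UNIV. ?B $ i $ j * w $ j)" for i
    unfolding u by (simp add: matrix_vector_mult_def)
  then have "act g (contract \<eta> u) = (\<Sum>i\<in>UNIV. \<Sum>j\<in>UNIV. act g (\<eta> i) * pconst (?B $ i $ j) * pconst (w $ j))"
    by (simp add: contract_def act_sum act_mult pconst_sum pconst_mult sum_distrib_left mult_ac)
  also have "\<dots> = (\<Sum>j\<in>UNIV. \<Sum>i\<in>UNIV. act g (\<eta> i) * pconst (?B $ i $ j) * pconst (w $ j))"
    by (rule sum.swap)
  also have "\<dots> = (\<Sum>j\<in>UNIV. pconst (chi g) * \<eta> j * pconst (w $ j))"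
    by (simp only: * sum_distrib_right[symmetric])
  also have "\<dots> = pconst (chi g) * contract \<eta> w"
    by (simp add: contract_def sum_distrib_left mult_ac)
  finally show ?thesis
    by (simp only: w)
qed

lemma det_contract:
  "det (\<chi> k j. contract (\<eta> k) (v j)) = top_wedge \<eta> * pconst (det (\<chi> i j. v j $ i))"
proof -
  have "(\<chi> k j. contract (\<eta> k) (v j)) = (\<chi> k j. \<eta> k j) ** (\<chi> i j. pconst ((\<chi> i j. v j $ i) $ i $ j))"
    by (simp add: matrix_matrix_mult_def contract_def)
  then show ?thesis
    by (simp only: det_mul det_pconst top_wedge_def)
qed

text \<open>The factors depend on \<open>g\<close> and \<open>chi\<close> only, not on the chosen
  forms, so they cancel in a quotient of two such wedges.\<close>

lemma act_top_wedge:
  fixes \<eta> :: "'n::finite \<Rightarrow> ('a::field, 'n) form1"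
  assumes "\<And>k. \<eta> k \<in> chi_forms G chi" "g \<in> G"
  shows "act g (top_wedge \<eta>) * pconst (det (matrix_inv g)) = pconst (chi g) ^ CARD('n) * top_wedge \<eta>"
proof -
  have *: "(\<Sum>i\<in>UNIV. act g (\<eta> k i) * pconst (matrix_inv g $ i $ j)) = pconst (chi g) * \<eta> k j" for k j
    using assms by (auto simp: chi_forms_def act_form_def fun_eq_iff)
  have "(\<chi> k j. act g (\<eta> k j)) ** (\<chi> i j. pconst (matrix_inv g $ i $ j)) = mat (pconst (chi g)) ** (\<chi> k j. \<eta> k j)"
    by (simp add: vec_eq_iff mat_mult_left) (simp add: matrix_matrix_mult_def *)
  from arg_cong[OF this, of det]
  have "det (\<chi> k j. act g (\<eta> k j)) * pconst (det (matrix_inv g)) = pconst (chi g) ^ CARD('n) * top_wedge \<eta>"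
    by (simp only: det_mul det_pconst det_mat top_wedge_def)
  then show ?thesis
    by (simp add: top_wedge_def act_det)
qed

subsection \<open>Roots of unity in a field\<close>

lemma card_roots_of_unity_le:
  assumes "n > 0"
  shows "finite {x::'a::field. x ^ n = 1}" "card {x::'a::field. x ^ n = 1} \<le> n"
proof -
  let ?p = "monom (1::'a) n + - 1"
  have deg: "degree ?p = n"
    using assms by (subst degree_add_eq_left) (auto simp: degree_monom_eq)
  then have "?p \<noteq> 0"
    using assms by auto
  moreover have "{x. x ^ n = 1} = {x. poly ?p x = 0}"
    by (simp add: poly_monom)
  ultimately show "finite {x::'a. x ^ n = 1}" "card {x::'a. x ^ n = 1} \<le> n"
    using poly_roots_finite[of ?p] card_poly_roots_bound[of ?p] deg by auto
qed

lemma primitive_root_power_inj: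
  fixes \<mu> :: "'a::field"
  assumes "\<mu> ^ n = 1" "\<And>k. 0 < k \<Longrightarrow> k < n \<Longrightarrow> \<mu> ^ k \<noteq> 1" "n > 0"
  shows "inj_on (\<lambda>k. \<mu> ^ k) {..<n}"
proof -
  have \<mu>: "\<mu> \<noteq> 0"
    using assms(1,3) by (metis power_0_left zero_neq_one less_irrefl)
  have "i = j" if "i \<le> j" "j < n" "\<mu> ^ i = \<mu> ^ j" for i j
  proof -
    have "\<mu> ^ i * \<mu> ^ (j - i) = \<mu> ^ i * 1"
      using that by (metis le_add_diff_inverse mult_1_right power_add)
    then have "\<mu> ^ (j - i) = 1"
      using \<mu> by simp
    then show ?thesis
      using assms(2)[of "j - i"] that by (cases "i < j") auto
  qed
  then show ?thesis
    unfolding inj_on_def by (metis lessThan_iff nle_le)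
qed

text \<open>The powers of \<mu> already give \<open>n\<close> distinct roots of
  \<open>X^n - 1\<close>, which has at most \<open>n\<close>.\<close>

lemma primitive_root_powers:
  fixes \<mu> x :: "'a::field"
  assumes "\<mu> ^ n = 1" "\<And>k. 0 < k \<Longrightarrow> k < n \<Longrightarrow> \<mu> ^ k \<noteq> 1" "n > 0" "x ^ n = 1"
  obtains k where "x = \<mu> ^ k"
proof -
  let ?P = "(\<lambda>k. \<mu> ^ k) ` {..<n}" and ?R = "{x::'a. x ^ n = 1}"
  have "card ?P = n"
    using primitive_root_power_inj[OF assms(1,2,3)] by (simp add: card_image)
  moreover have "?P \<subseteq> ?R"
    using assms(1) by (auto simp flip: power_mult) (simp add: power_mult mult.commute[of _ n])
  ultimately have "?P = ?R"
    using card_roots_of_unity_le[OF assms(3), where ?'a = 'a] by (intro card_seteq) auto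
  then show ?thesis
    using that assms(4) by auto
qed

text \<open>The conclusion says that \<open>y\<close> has order exactly the full power of
  \<open>p\<close> in \<open>card A\<close>. Too few elements satisfy
  \<open>x ^ (card A div p) = 1\<close> to fill \<open>A\<close>; any other element, raised to the
  part of \<open>card A\<close> prime to \<open>p\<close>, will do.\<close>

lemma exists_order_prime_power:
  fixes A :: "'a::field set"
  assumes "finite A" "\<And>x. x \<in> A \<Longrightarrow> x ^ card A = 1" "\<And>x y. x \<in> A \<Longrightarrow> y \<in> A \<Longrightarrow> x * y \<in> A" "1 \<in> A"
    and p: "prime p" "p dvd card A"
  obtains y where "y \<in> A" "y ^ (p ^ multiplicity p (card A)) = 1" "y ^ (card A div p) \<noteq> 1"
proof -
  let ?e = "card A" and ?m = "multiplicity p (card A)"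
  have e: "?e > 0"
    using assms(1,4) by (auto simp: card_gt_0_iff)
  obtain d where d: "?e = p * d"
    using p(2) ..
  have d0: "d > 0" "d < ?e"
    using e d prime_gt_1_nat[OF p(1)] by auto
  have "\<not> A \<subseteq> {x. x ^ d = 1}"
    using card_mono[of "{x. x ^ d = 1}" A] card_roots_of_unity_le[OF d0(1), where ?'a = 'a] d0(2) by auto
  then obtain x where x: "x \<in> A" "x ^ d \<noteq> 1"
    by auto
  obtain c where c: "?e = p ^ ?m * c" "\<not> p dvd c"
    using multiplicity_decompose'[of ?e p] e p(1) by (metis not_prime_unit less_numeral_extra(3))
  have m: "?m > 0"
    using p e by (simp add: prime_multiplicity_gt_zero_iff)
  have dc: "d = p ^ (?m - 1) * c"
    using c(1) d m prime_gt_0_nat[OF p(1)] by (cases ?m) auto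
  have pow: "x ^ k \<in> A" for k
    using x(1) assms(3,4) by (induction k) auto
  define z where "z = x ^ d"
  have z: "z ^ p = 1" "z \<noteq> 1"
    using assms(2)[OF x(1)] x(2) by (simp_all add: z_def d mult.commute flip: power_mult)
  have "coprime c p"
    using prime_imp_coprime[OF p(1) c(2)] by (simp add: coprime_commute)
  \<comment> \<open>\<open>z\<close> has order \<open>p\<close>, and \<open>c\<close> is prime to
    \<open>p\<close>, so by Bezout \<open>z\<close> is a power of \<open>z ^ c\<close>.\<close>
  have zc: "z ^ c \<noteq> 1"
  proof
    assume zc: "z ^ c = 1"
    obtain u v where uv: "c * u = p * v + 1"
      using coprime_bezout_strong[OF \<open>coprime c p\<close>] prime_gt_1_nat[OF p(1)] by auto
    have "z = z ^ (p * v + 1)"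
      by (simp add: power_add power_mult z(1))
    also have "\<dots> = 1"
      unfolding uv[symmetric] by (simp add: power_mult zc)
    finally show False
      using z(2) by simp
  qed
  have "(x ^ c) ^ (?e div p) = z ^ c"
    using prime_gt_0_nat[OF p(1)] by (simp add: d z_def mult.commute flip: power_mult)
  moreover have "(x ^ c) ^ (p ^ ?m) = 1"
    using assms(2)[OF x(1)] c(1) by (metis mult.commute power_mult)
  ultimately show ?thesis
    using that[of "x ^ c"] pow zc by simp
qed

text \<open>A generator is the product, over the primes \<open>p\<close> dividing
  \<open>card A\<close>, of elements whose order is the full power of \<open>p\<close> in
  \<open>card A\<close>.\<close>

lemma finite_field_subgroup_cyclic:
  fixes A :: "'a::field set"
  assumes "finite A" "1 \<in> A" "0 \<notin> A" "\<And>x y. x \<in> A \<Longrightarrow> y \<in> A \<Longrightarrow> x * y \<in> A"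
  obtains \<mu> where "\<mu> \<in> A" "\<mu> ^ card A = 1" "\<And>k. 0 < k \<Longrightarrow> k < card A \<Longrightarrow> \<mu> ^ k \<noteq> 1"
    "\<And>x. x \<in> A \<Longrightarrow> \<exists>k. x = \<mu> ^ k"
proof -
  let ?e = "card A"
  have e: "?e > 0"
    using assms(1,2) by (auto simp: card_gt_0_iff)
  \<comment> \<open>Multiplication by \<open>x\<close> permutes \<open>A\<close>; compare the
    products of all elements.\<close>
  have lagrange: "x ^ ?e = 1" if "x \<in> A" for x
  proof -
    have "inj_on ((*) x) A"
      using that assms(3) by (auto simp: inj_on_def)
    moreover have "(*) x ` A \<subseteq> A"
      using that assms(4) by auto
    ultimately have "(*) x ` A = A"
      using assms(1) endo_inj_surj by blast
    then have "\<Prod>A = (\<Prod>a\<in>A. x * a)"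
      using prod.reindex[OF \<open>inj_on ((*) x) A\<close>, of id] by (simp add: comp_def)
    also have "\<dots> = x ^ ?e * \<Prod>A"
      by (simp add: prod.distrib)
    finally have "x ^ ?e * \<Prod>A = 1 * \<Prod>A"
      by simp
    moreover have "\<Prod>A \<noteq> 0"
      using assms(1,3) by auto
    ultimately show ?thesis
      by simp
  qed
  define Ps where "Ps = {p. prime p \<and> p dvd ?e}"
  have fin: "finite Ps"
    using e by (intro finite_subset[of Ps "{..?e}"]) (auto simp: Ps_def dvd_imp_le)
  have "\<forall>p\<in>Ps. \<exists>y. y \<in> A \<and> y ^ (p ^ multiplicity p ?e) = 1 \<and> y ^ (?e div p) \<noteq> 1"
    unfolding Ps_def
    using exists_order_prime_power[OF assms(1) lagrange assms(4,2)] by (metis (no_types, lifting) mem_Collect_eq)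
  then obtain y where y: "\<And>p. p \<in> Ps \<Longrightarrow> y p \<in> A \<and> y p ^ (p ^ multiplicity p ?e) = 1 \<and> y p ^ (?e div p) \<noteq> 1"
    by metis
  define \<mu> where "\<mu> = (\<Prod>p\<in>Ps. y p)"
  have "(\<Prod>p\<in>I. y p) \<in> A" if "finite I" "I \<subseteq> Ps" for I
    using that by induction (auto intro: assms(2,4) simp: y)
  then have \<mu>A: "\<mu> \<in> A"
    using fin by (simp add: \<mu>_def)
  \<comment> \<open>Raising to this power kills every factor of \<mu> except the one belonging to
    \<open>p\<close>.\<close>
  have nontriv: "\<mu> ^ (?e div p) \<noteq> 1" if p: "p \<in> Ps" for p
  proof -
    have "y r ^ (?e div p) = 1" if "r \<in> Ps - {p}" for r
    proof -
      have pr: "prime p" "p dvd ?e" "prime r" "r \<noteq> p"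
        using p that by (auto simp: Ps_def)
      have "coprime (r ^ multiplicity r ?e) p"
        using pr by (simp add: primes_coprime)
      moreover have "r ^ multiplicity r ?e dvd p * (?e div p)"
        using pr multiplicity_dvd[of r ?e] by simp
      ultimately have "r ^ multiplicity r ?e dvd ?e div p"
        by (simp add: coprime_dvd_mult_right_iff)
      then obtain k where "?e div p = r ^ multiplicity r ?e * k" ..
      then show ?thesis
        using y[of r] that by (simp add: power_mult)
    qed
    then have "\<mu> ^ (?e div p) = y p ^ (?e div p)"
      unfolding \<mu>_def prod.remove[OF fin p] by (simp add: power_mult_distrib prod_power_distrib)
    then show ?thesis
      using y[OF p] by simp
  qed
  have primitive: "\<mu> ^ k \<noteq> 1" if k: "0 < k" "k < ?e" for k
  proof
    assume "\<mu> ^ k = 1"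
    \<comment> \<open>The gcd is again an exponent killing \<mu>, and as a proper divisor of
      \<open>?e\<close> it divides \<open>?e div p\<close> for some prime \<open>p\<close>.\<close>
    let ?g = "gcd k ?e"
    have "\<mu> ^ ?g = 1"
    proof -
      obtain u v where uv: "k * u = ?e * v + ?g"
        using bezout_nat[of k ?e] k by auto
      have "\<mu> ^ ?g = \<mu> ^ (?e * v + ?g)"
        by (simp add: power_add power_mult lagrange[OF \<mu>A])
      also have "\<dots> = 1"
        unfolding uv[symmetric] by (simp add: power_mult \<open>\<mu> ^ k = 1\<close>)
      finally show ?thesis .
    qed
    have g: "?g dvd ?e" "?g < ?e"
      using k by (auto intro: le_less_trans[OF gcd_le1_nat])
    obtain d where d: "?e = ?g * d"
      using g(1) by (rule dvdE)
    have "d \<noteq> 1"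
    proof
      assume "d = 1"
      with d have "?e = ?g"
        by (metis mult.right_neutral)
      with g(2) show False
        by simp
    qed
    then obtain p where p: "prime p" "p dvd d"
      using prime_factor_nat by blast
    then obtain d' where d': "d = p * d'"
      by (meson dvdE)
    have "p \<in> Ps"
      using p dvd_mult[OF p(2), of ?g] unfolding Ps_def by (simp flip: d)
    moreover have "?e div p = ?g * d'"
    proof -
      have "?e = p * (?g * d')"
        using d d' by (metis mult.left_commute)
      then show ?thesis
        using prime_gt_0_nat[OF p(1)] by (metis nonzero_mult_div_cancel_left not_gr_zero)
    qed
    then have "\<mu> ^ (?e div p) = 1"
      by (simp add: power_mult \<open>\<mu> ^ ?g = 1\<close>)
    ultimately show False
      using nontriv by blast
  qed
  moreover have "\<exists>k. x = \<mu> ^ k" if "x \<in> A" for x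
    by (rule primitive_root_powers[OF lagrange[OF \<mu>A] primitive e lagrange[OF that]]) auto
  ultimately show ?thesis
    by (intro that[OF \<mu>A lagrange[OF \<mu>A]])
qed

text \<open>Frobenius is additive, so \<open>x - 1\<close> has vanishing power. This forces
  characters to be trivial on transvections.\<close>

lemma power_eq_1_imp_eq_1_char:
  fixes x :: "'a::field"
  assumes "x ^ CHAR('a) = 1" "CHAR('a) > 0"
  shows "x = 1"
proof -
  have p: "prime CHAR('a)"
    using assms(2) by (rule prime_CHAR_semidom)
  have "(x - 1 + 1) ^ CHAR('a) = (x - 1) ^ CHAR('a) + 1 ^ CHAR('a)"
    by (rule freshmans_dream[OF p refl])
  then have "(x - 1) ^ CHAR('a) = 0"
    using assms(1) by simp
  then show ?thesis
    by simp
qed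

subsection \<open>Pointwise stabilizers of hyperplanes\<close>

lemma mpow_0 [simp]: "mpow g 0 = mat 1"
  and mpow_Suc: "mpow g (Suc k) = g ** mpow g k"
  by (simp_all add: mpow_def)

lemma det_mpow: "det (mpow g k) = det g ^ k"
  by (induction k) (simp_all add: mpow_Suc det_mul)

lemma mpow_fixes: "g *v v = v \<Longrightarrow> mpow g k *v v = v"
  by (induction k) (simp_all add: mpow_Suc flip: matrix_vector_mul_assoc)

lemma mpow_eigenvector: "g *v v = \<mu> *s v \<Longrightarrow> mpow g k *v v = \<mu> ^ k *s v"
proof (induction k)
  case (Suc k)
  then show ?case
    by (simp add: mpow_Suc vec.scale mult.commute flip: matrix_vector_mul_assoc)
qed simp

lemma mpow_shear_transvection:
  assumes "shear l \<beta> g" "lform l \<beta> = 0"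
  shows "shear l (of_nat k *s \<beta>) (mpow g k)"
proof (induction k)
  case (Suc k)
  show ?case
    unfolding shear_def
  proof
    fix v
    have "mpow g (Suc k) *v v = g *v (v + lform l v *s (of_nat k *s \<beta>))"
      using Suc by (simp add: mpow_Suc shear_def flip: matrix_vector_mul_assoc)
    also have "\<dots> = v + lform l v *s (of_nat (Suc k) *s \<beta>)"
      using assms by (simp add: shear_def lform_add lform_scale vec_eq_iff algebra_simps)
    finally show "mpow g (Suc k) *v v = v + lform l v *s (of_nat (Suc k) *s \<beta>)" .
  qed
qed (simp add: shear_def)

lemma def_form_hyperplane:
  assumes "is_hyperplane H"
  shows "def_form H \<noteq> 0" "H = {v. lform (def_form H) v = 0}"
  using someI_ex[OF assms[unfolded is_hyperplane_def]] unfolding def_form_def by auto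

lemma shear_unique:
  assumes "shear l \<alpha> g" "shear l \<beta> g" "l \<noteq> 0"
  shows "\<alpha> = \<beta>"
proof -
  obtain u where "lform l u = 1"
    using assms(3) by (rule lform_surj)
  then show ?thesis
    using assms(1,2) unfolding shear_def by (metis add_left_cancel vec.scale_one)
qed

lemma shear_mat_1: "shear l 0 (mat 1)"
  by (simp add: shear_def)

lemma shear_0_eq_mat_1: "shear l 0 g \<Longrightarrow> g = mat 1"
  by (simp add: shear_def matrix_eq)

lemma fixspace_shear:
  assumes "l \<noteq> 0" "shear l \<alpha> g" "g \<noteq> mat 1"
  shows "fixspace g = {v. lform l v = 0}"
proof -
  have "\<alpha> \<noteq> 0"
    using assms(2,3) by (auto simp: shear_def matrix_eq)
  then show ?thesis
    using assms(2) by (auto simp: fixspace_def shear_def)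
qed

text \<open>As \<alpha> lies off the hyperplane, V is the sum of the hyperplane, fixed by
  \<open>g\<close>, and the line of \<alpha>, scaled by \<open>det g\<close>.\<close>

lemma mpow_eq_1_of_det:
  assumes "shear l \<alpha> g" "l \<noteq> 0" "lform l \<alpha> \<noteq> 0" "det g ^ k = 1"
  shows "mpow g k = mat 1"
proof -
  have "mpow g k *v v = v" for v
  proof -
    let ?c = "lform l v / lform l \<alpha>"
    have "g *v \<alpha> = det g *s \<alpha>"
      using shear_root_eigenvector[OF assms(1)] det_shear[OF assms(1,2)] by simp
    then have 1: "mpow g k *v \<alpha> = \<alpha>"
      using mpow_eigenvector[of g \<alpha> "det g" k] assms(4) by simp
    have "g *v (v - ?c *s \<alpha>) = v - ?c *s \<alpha>"
      using assms(1,3) by (simp add: shear_def lform_diff lform_scale)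
    then have "mpow g k *v (v - ?c *s \<alpha>) = v - ?c *s \<alpha>"
      by (rule mpow_fixes)
    then show ?thesis
      by (simp add: vec.diff vec.scale 1)
  qed
  then show ?thesis
    by (simp add: matrix_eq)
qed

lemma mgen_mpow: "s \<in> S \<Longrightarrow> x \<in> mgen S \<Longrightarrow> mpow s k ** x \<in> mgen S"
  by (induction k) (auto simp: mpow_Suc intro: mgen_mult simp flip: matrix_mul_assoc)

context
  fixes G :: "('a::field ^ 'n ^ 'n::finite) set"
  assumes G: "matrix_group G"
begin

lemma group_mpow: "g \<in> G \<Longrightarrow> mpow g k \<in> G"
  using G by (induction k) (auto simp: mpow_Suc matrix_group_def)

lemma group_finite_order:
  assumes g: "g \<in> G"
  obtains k where "k > 0" "mpow g k = mat 1"
proof -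
  have inv: "invertible g"
    using G g by (simp add: matrix_group_def)
  have "range (mpow g) \<subseteq> G"
    using g group_mpow by auto
  then have "finite (range (mpow g))"
    using G finite_subset unfolding matrix_group_def by blast
  then have "\<not> inj (mpow g)"
    using finite_imageD[of "mpow g" UNIV] infinite_UNIV_nat by blast
  then obtain i j where ij: "i < j" "mpow g i = mpow g j"
    using linorder_injI[of "mpow g"] by blast
  have cancel: "mpow g i = mpow g (i + d) \<Longrightarrow> mpow g d = mat 1" for i d
  proof (induction i)
    case (Suc i)
    then have "matrix_inv g ** (g ** mpow g i) = matrix_inv g ** (g ** mpow g (i + d))"
      by (simp add: mpow_Suc)
    then have "mpow g i = mpow g (i + d)"
      by (simp add: matrix_mul_assoc matrix_inv_left inv)
    then show ?case
      by (rule Suc.IH)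
  qed simp
  show ?thesis
    using ij cancel[of i "j - i"] by (intro that[of "j - i"]) simp_all
qed

lemma pstab_group: "matrix_group (pstab G H)"
proof -
  have "matrix_inv g *v v = v" if "g \<in> G" "g *v v = v" for g v
  proof -
    have "matrix_inv g *v (g *v v) = v"
      using G that(1) by (simp add: matrix_group_def matrix_vector_mul_assoc matrix_inv_left)
    with that(2) show ?thesis by simp
  qed
  moreover have "(g ** h) *v v = v" if "g *v v = v" "h *v v = v" for g h :: "'a ^ 'n ^ 'n" and v
    using that by (simp flip: matrix_vector_mul_assoc)
  ultimately show ?thesis
    using G unfolding matrix_group_def pstab_def by simp
qed

text \<open>The fibres of \<open>det\<close> on the stabilizer are cosets of \<open>K_H G H\<close>.
  The index thereby becomes the size of a finite subgroup of the field, which is cyclic.\<close>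

lemma e_H_eq_card_det: "e_H G H = card (det ` pstab G H)"
proof -
  let ?P = "pstab G H" and ?K = "K_H G H"
  have P: "finite ?P" "mat 1 \<in> ?P" "\<And>g. g \<in> ?P \<Longrightarrow> invertible g \<and> matrix_inv g \<in> ?P"
    "\<And>g h. g \<in> ?P \<Longrightarrow> h \<in> ?P \<Longrightarrow> g ** h \<in> ?P"
    using pstab_group[of H] by (auto simp: matrix_group_def)
  have fiber: "card {h \<in> ?P. det h = det g} = card ?K" if g: "g \<in> ?P" for g
  proof -
    have inv: "invertible g" "matrix_inv g \<in> ?P" "det g \<noteq> 0"
      using P(3)[OF g] invertible_det_nz by auto
    have det_inv: "det (matrix_inv g) * det g = 1"
      by (simp add: matrix_inv_left[OF inv(1)] flip: det_mul)
    have "bij_betw ((**) g) ?K {h \<in> ?P. det h = det g}"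
    proof (rule bij_betw_byWitness[of _ "(**) (matrix_inv g)"])
      show "(**) g ` ?K \<subseteq> {h \<in> ?P. det h = det g}"
        using g P(4) by (auto simp: K_H_def det_mul)
      show "(**) (matrix_inv g) ` {h \<in> ?P. det h = det g} \<subseteq> ?K"
        using inv P(4) det_inv by (auto simp: K_H_def det_mul)
    qed (auto simp: matrix_mul_assoc matrix_inv_left matrix_inv_right inv(1))
    then show ?thesis
      by (simp add: bij_betw_same_card)
  qed
  have "card ?P = (\<Sum>x\<in>det ` ?P. card {h \<in> ?P. det h = x})"
    using sum.group[of ?P "det ` ?P" det "\<lambda>_. 1::nat"] P(1) by simp
  also have "\<dots> = (\<Sum>x\<in>det ` ?P. card ?K)"
    by (intro sum.cong refl) (auto simp: fiber)
  finally have "card ?P = card (det ` ?P) * card ?K"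
    by simp
  moreover have "card ?K > 0"
    using P(1,2) by (auto simp: card_gt_0_iff K_H_def)
  ultimately show ?thesis
    by (simp add: e_H_def)
qed

text \<open>Justifies the choice in \<open>s_H\<close>: take an element whose determinant generates
  the cyclic group of determinants. If that group is nontrivial, the determinant differs from 1, so
  the root lies off H and the order is that of the determinant.\<close>

lemma s_H_exists:
  assumes H: "is_hyperplane H"
  shows "\<exists>s. s \<in> pstab G H \<and> has_order s (e_H G H)
      \<and> pstab G H = mgen (insert s (K_H G H))
      \<and> (if e_H G H = 1 then s = mat 1 else is_diag_reflection s)"
proof -
  let ?P = "pstab G H" and ?K = "K_H G H" and ?e = "e_H G H"
  let ?l = "def_form H"
  note l = def_form_hyperplane[OF H]
  obtain u where u: "lform ?l u = 1"
    using l(1) by (rule lform_surj)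
  have P: "finite ?P" "mat 1 \<in> ?P" "\<And>g. g \<in> ?P \<Longrightarrow> invertible g \<and> matrix_inv g \<in> ?P"
    "\<And>g h. g \<in> ?P \<Longrightarrow> h \<in> ?P \<Longrightarrow> g ** h \<in> ?P"
    using pstab_group[of H] by (auto simp: matrix_group_def)
  have det_nz: "det g \<noteq> 0" if "g \<in> ?P" for g
    using P(3)[OF that] invertible_det_nz by blast
  define D where "D = det ` ?P"
  have "finite D"
    using P(1) by (simp add: D_def)
  moreover have "1 \<in> D"
    unfolding D_def using P(2) by (metis det_I imageI)
  moreover have "0 \<notin> D"
    using det_nz by (auto simp: D_def)
  moreover have "x * y \<in> D" if "x \<in> D" "y \<in> D" for x y
    using that P(4) unfolding D_def by (force simp flip: det_mul)
  moreover have "?e = card D"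
    by (simp add: e_H_eq_card_det D_def)
  ultimately obtain \<mu> where \<mu>: "\<mu> \<in> D" "\<mu> ^ ?e = 1" "\<And>k. 0 < k \<Longrightarrow> k < ?e \<Longrightarrow> \<mu> ^ k \<noteq> 1"
      and powers: "\<And>x. x \<in> D \<Longrightarrow> \<exists>k. x = \<mu> ^ k"
    using finite_field_subgroup_cyclic[of D] by metis
  have e: "?e > 0"
    using P(1,2) by (auto simp: e_H_eq_card_det card_gt_0_iff)
  \<comment> \<open>For \<open>?e = 1\<close> all determinants are 1, and the identity has to be
    picked rather than, say, a transvection.\<close>
  obtain s where s: "s \<in> ?P" "det s = \<mu>" "?e = 1 \<Longrightarrow> s = mat 1"
  proof (cases "?e = 1")
    case True
    then have "\<mu> = 1"
      using \<mu>(2) by simp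
    then show ?thesis
      using that[of "mat 1"] P(2) by simp
  next
    case False
    then show ?thesis
      using \<mu>(1) that unfolding D_def by blast
  qed
  have sh: "shear ?l (s *v u - u) s"
    using s(1) u l(2) pstab_shear by metis
  have root: "lform ?l (s *v u - u) \<noteq> 0" if "?e \<noteq> 1"
  proof -
    have "\<mu> \<noteq> 1"
      using \<mu>(3)[of 1] that e by auto
    then show ?thesis
      using det_shear[OF sh l(1)] s(2) by auto
  qed
  have order: "has_order s ?e"
  proof (cases "?e = 1")
    case True
    then show ?thesis
      using s(3) by (auto simp: has_order_def mpow_Suc)
  next
    case False
    have "mpow s k \<noteq> mat 1" if "0 < k" "k < ?e" for k
      using \<mu>(3)[OF that] s(2) by (metis det_I det_mpow)
    then show ?thesis
      using mpow_eq_1_of_det[OF sh l(1) root[OF False], of ?e] s(2) \<mu>(2) e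
      by (simp add: has_order_def)
  qed
  have "is_diag_reflection s" if ne: "?e \<noteq> 1"
  proof -
    have "s \<noteq> mat 1"
      using \<mu>(3)[of 1] ne e s(2) by auto
    then have fixs: "fixspace s = H"
      using fixspace_shear[OF l(1) sh] l(2) by simp
    have "is_reflection s"
      unfolding is_reflection_def fixs using P(3)[OF s(1)] order H unfolding has_order_def by blast
    then show ?thesis
      unfolding is_diag_reflection_def fixs using sh root[OF ne] unfolding shear_def by blast
  qed
  moreover have "mgen (insert s ?K) \<subseteq> ?P"
  proof
    fix x assume "x \<in> mgen (insert s ?K)"
    then show "x \<in> ?P"
    proof induction
      case (mgen_mult g x)
      then have "g \<in> ?P"
        using s(1) by (auto simp: K_H_def)
      then show ?case
        using mgen_mult P(4) by blast
    qed (rule P(2))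
  qed
  moreover have "?P \<subseteq> mgen (insert s ?K)"
  proof
    fix g assume g: "g \<in> ?P"
    then obtain k where k: "det g = \<mu> ^ k"
      using powers unfolding D_def by blast
    \<comment> \<open>A power of \<open>s\<close> with the determinant of \<open>g\<close>; the two
      differ by an element of \<open>?K\<close>.\<close>
    let ?t = "mpow s k"
    have t: "?t \<in> ?P"
      using P(2) P(4)[OF s(1)] by (induction k) (simp_all add: mpow_Suc)
    have "det (matrix_inv ?t) * det ?t = 1"
      using P(3)[OF t] by (simp add: matrix_inv_left flip: det_mul)
    then have "det (matrix_inv ?t ** g) = 1"
      using k s(2) by (simp add: det_mul det_mpow)
    then have "matrix_inv ?t ** g \<in> ?K"
      using P(3)[OF t] P(4) g by (simp add: K_H_def)
    then have "(matrix_inv ?t ** g) ** mat 1 \<in> mgen (insert s ?K)"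
      by (intro mgen_mult mgen_one) auto
    then have "?t ** (matrix_inv ?t ** g) \<in> mgen (insert s ?K)"
      by (intro mgen_mpow) auto
    then show "g \<in> mgen (insert s ?K)"
      using P(3)[OF t] by (simp add: matrix_mul_assoc matrix_inv_right)
  qed
  ultimately show ?thesis
    using s order by (intro exI[of _ s]) auto
qed

lemma s_H_spec:
  assumes "is_hyperplane H"
  shows "s_H G H \<in> pstab G H" "has_order (s_H G H) (e_H G H)"
    "e_H G H = 1 \<Longrightarrow> s_H G H = mat 1" "e_H G H \<noteq> 1 \<Longrightarrow> is_diag_reflection (s_H G H)"
  using someI_ex[OF s_H_exists[OF assms], folded s_H_def] by auto

text \<open>Treats both cases alike: \<alpha> is the root of \<open>s\<close> when \<open>e\<close>
  is not 1, and any vector off H when \<open>s\<close> is the identity. The root \<rho> is kept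
  apart from \<alpha> because it is 0 in the second case.\<close>

lemma s_H_eigenvector:
  fixes H
  defines "s \<equiv> s_H G H" and "e \<equiv> e_H G H" and "l \<equiv> def_form H"
  assumes H: "is_hyperplane H"
  obtains \<rho> \<alpha> where "shear l \<rho> s" "lform l \<alpha> \<noteq> 0" "s *v \<alpha> = det s *s \<alpha>"
    "det s ^ e = 1" "\<And>k. 0 < k \<Longrightarrow> k < e \<Longrightarrow> det s ^ k \<noteq> 1" "e > 0"
proof -
  note l = def_form_hyperplane[OF H, folded l_def]
  note s = s_H_spec[OF H, folded s_def e_def]
  obtain u where u: "lform l u = 1"
    using l(1) by (rule lform_surj)
  have e: "e > 0" "mpow s e = mat 1" "\<And>k. 0 < k \<Longrightarrow> k < e \<Longrightarrow> mpow s k \<noteq> mat 1"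
    using s(2) by (auto simp: has_order_def)
  have det_e: "det s ^ e = 1"
    using det_mpow[of s e] e(2) by simp
  show ?thesis
  proof (cases "e = 1")
    case True
    then show ?thesis
      using that[of 0 u] s(3) u shear_mat_1[of l] by simp
  next
    case False
    have sh: "shear l (s *v u - u) s"
      using pstab_shear[of s G l u] s(1) l(2) u by simp
    have "s \<noteq> mat 1"
      using e(3)[of 1] e(1) False by (simp add: mpow_Suc)
    then have "fixspace s = H"
      using fixspace_shear[OF l(1) sh] l(2) by simp
    then obtain \<rho> where \<rho>: "shear l \<rho> s" "lform l \<rho> \<noteq> 0"
      using s(4)[OF False] unfolding is_diag_reflection_def shear_def l_def by auto
    have "s *v \<rho> = det s *s \<rho>"
      using shear_root_eigenvector[OF \<rho>(1)] det_shear[OF \<rho>(1) l(1)] by simp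
    moreover have "det s ^ k \<noteq> 1" if "0 < k" "k < e" for k
      using mpow_eq_1_of_det[OF \<rho>(1) l(1) \<rho>(2), of k] e(3)[OF that] by blast
    ultimately show ?thesis
      using that \<rho> det_e e(1) by blast
  qed
qed

text \<open>The inverse of \<open>det (s_H G H)\<close> is a primitive root of unity of order
  \<open>e_H G H\<close>, so the value of \<open>psi\<close> is one of its powers and the
  \<open>LEAST\<close> is attained. Minimality is stated in the form that
  \<open>semi_invariant_dvd\<close> takes.\<close>

lemma a_H_spec:
  assumes H: "is_hyperplane H" and psi: "psi (s_H G H) ^ e_H G H = 1"
  shows "psi (s_H G H) = inverse (det (s_H G H)) ^ a_H G H psi"
    "b < a_H G H psi \<Longrightarrow> inverse (det (s_H G H)) ^ b \<noteq> inverse (det (s_H G H)) ^ a_H G H psi"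
proof -
  let ?s = "s_H G H" and ?e = "e_H G H"
  have e: "det ?s ^ ?e = 1" "\<And>k. 0 < k \<Longrightarrow> k < ?e \<Longrightarrow> det ?s ^ k \<noteq> 1" "?e > 0"
    using s_H_eigenvector[OF H] by metis+
  have "inverse (det ?s) ^ ?e = 1"
    using e(1) by (simp add: power_inverse)
  moreover have "inverse (det ?s) ^ k \<noteq> 1" if "0 < k" "k < ?e" for k
    using e(2)[OF that] by (simp add: power_inverse)
  ultimately obtain k where "psi ?s = inverse (det ?s) ^ k"
    using e(3) psi by (rule primitive_root_powers)
  then show *: "psi ?s = inverse (det ?s) ^ a_H G H psi"
    unfolding a_H_def by (rule LeastI)
  show "inverse (det ?s) ^ b \<noteq> inverse (det ?s) ^ a_H G H psi" if "b < a_H G H psi"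
    using not_less_Least[OF that[unfolded a_H_def]] * by metis
qed

text \<open>\<open>is_transvection\<close> refers to the form of \<open>fixspace t\<close>,
  \<open>trans_roots\<close> to that of \<open>H\<close>. For a nonzero root the two hyperplanes
  coincide, and uniqueness of the root gives that \<beta> lies in \<open>H\<close>.\<close>

lemma trans_roots_shear:
  assumes H: "is_hyperplane H" and "\<beta> \<in> trans_roots G H"
  obtains t where "t \<in> G" "invertible t" "shear (def_form H) \<beta> t" "lform (def_form H) \<beta> = 0"
proof -
  note l = def_form_hyperplane[OF H]
  obtain t where t: "t \<in> pstab G H" "is_transvection t" "shear (def_form H) \<beta> t"
    using assms(2) unfolding trans_roots_def shear_def by blast
  have tG: "t \<in> G" "invertible t"
    using t(1) G by (auto simp: pstab_def matrix_group_def)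
  have "lform (def_form H) \<beta> = 0"
  proof (cases "\<beta> = 0")
    case True
    then show ?thesis
      by (simp add: lform_0)
  next
    case False
    then have "t \<noteq> mat 1"
      using shear_unique[OF t(3) _ l(1)] shear_mat_1 by blast
    then have "fixspace t = H"
      using fixspace_shear[OF l(1) t(3)] l(2) by simp
    then obtain \<gamma> where "shear (def_form H) \<gamma> t" "lform (def_form H) \<gamma> = 0"
      using t(2) unfolding is_transvection_def shear_def by auto
    then show ?thesis
      using shear_unique[OF t(3) _ l(1)] by blast
  qed
  then show ?thesis
    using that tG t(3) by blast
qed

end

subsection \<open>Divisibility along one hyperplane\<close>

lemma pconst_mult_dvd_iff:
  assumes "(x::'a::field) \<noteq> 0"
  shows "p dvd pconst x * q \<longleftrightarrow> p dvd q"
proof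
  assume "p dvd pconst x * q"
  then have "p dvd pconst (inverse x) * (pconst x * q)"
    by (rule dvd_mult)
  then show "p dvd q"
    using pconst_inverse[OF assms] by (metis mult.assoc mult.commute mult_1)
qed simp

context
  fixes G :: "('a::field ^ 'n ^ 'n::finite) set" and chi :: "'a ^ 'n ^ 'n \<Rightarrow> 'a"
  assumes G: "matrix_group G" and chi: "lin_char G chi"
begin

lemma chi_mat_1: "chi (mat 1) = 1"
proof -
  have "mat 1 \<in> G"
    using G by (simp add: matrix_group_def)
  then have "chi (mat 1) * chi (mat 1) = chi (mat 1) * 1" "chi (mat 1) \<noteq> 0"
    using chi unfolding lin_char_def by (metis matrix_mul_lid mult.right_neutral)+
  then show ?thesis
    by simp
qed

lemma chi_mpow: "g \<in> G \<Longrightarrow> chi (mpow g k) = chi g ^ k"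
proof (induction k)
  case (Suc k)
  then show ?case
    using chi group_mpow[OF G Suc.prems] by (simp add: mpow_Suc lin_char_def)
qed (simp add: chi_mat_1)

text \<open>The powers of \<open>g\<close> have roots \<open>of_nat k *s \<beta>\<close>. For
  nonzero \<beta>, finite order forces positive characteristic p with p-th power of \<open>g\<close>
  trivial, and the only p-th root of 1 in the field is 1.\<close>

lemma chi_transvection:
  assumes g: "g \<in> G" and "shear l \<beta> g" "l \<noteq> 0" "lform l \<beta> = 0"
  shows "chi g = 1"
proof (cases "\<beta> = 0")
  case True
  then show ?thesis
    using shear_0_eq_mat_1 assms(2) chi_mat_1 by metis
next
  case False
  obtain k where k: "k > 0" "mpow g k = mat 1"
    using group_finite_order[OF G g] by blast
  have "of_nat k *s \<beta> = 0"
    using mpow_shear_transvection[OF assms(2,4), of k] k(2) shear_mat_1 shear_unique[OF _ _ assms(3)]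
    by metis
  then have "of_nat k = (0::'a)"
    using False by simp
  then have "CHAR('a) dvd k"
    by (simp add: of_nat_eq_0_iff_char_dvd)
  then have char: "CHAR('a) > 0"
    using k(1) by (auto intro: Nat.gr0I)
  have "shear l 0 (mpow g CHAR('a))"
    using mpow_shear_transvection[OF assms(2,4), of "CHAR('a)"] by simp
  then have "chi g ^ CHAR('a) = 1"
    using chi_mpow[OF g, of "CHAR('a)"] shear_0_eq_mat_1 chi_mat_1 by metis
  then show ?thesis
    using char by (rule power_eq_1_imp_eq_1_char)
qed

lemma lin_poly_power_dvd_top_wedge:
  fixes \<eta> :: "'n \<Rightarrow> ('a, 'n) form1"
  assumes H: "is_hyperplane H" and \<eta>: "\<And>i. \<eta> i \<in> chi_forms G chi"
  shows "lin_poly (def_form H) ^ ((if chi (s_H G H) = 1 then e_H G H * b_H G H else 0)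
      + a_H G H chi * (CARD('n) - 1) + a_H G H (\<lambda>g. chi g * det g)) dvd top_wedge \<eta>"
proof -
  let ?e = "e_H G H"
  define l where "l = def_form H"
  define s where "s = s_H G H"
  define a where "a = a_H G H chi"
  define a' where "a' = a_H G H (\<lambda>g. chi g * det g)"
  note l = def_form_hyperplane[OF H, folded l_def]
  obtain \<rho> \<alpha> where \<rho>: "shear l \<rho> s" and \<alpha>: "lform l \<alpha> \<noteq> 0" "s *v \<alpha> = det s *s \<alpha>"
      and e: "det s ^ ?e = 1" "\<And>k. 0 < k \<Longrightarrow> k < ?e \<Longrightarrow> det s ^ k \<noteq> 1" "?e > 0"
    using s_H_eigenvector[OF G H, folded l_def s_def] by blast
  have sP: "s \<in> pstab G H"
    using s_H_spec[OF G H] by (simp add: s_def)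
  have sG: "s \<in> G" "invertible s"
    using sP G by (auto simp: pstab_def matrix_group_def)
  have det_s: "inverse (det s) = inverse (1 + lform l \<rho>)"
    using det_shear[OF \<rho> l(1)] by simp
  have chi_e: "chi s ^ ?e = 1"
    using chi_mpow[OF sG(1), of ?e] s_H_spec(2)[OF G H] chi_mat_1 by (simp add: s_def has_order_def)
  have a: "chi s = inverse (det s) ^ a" "\<And>b. b < a \<Longrightarrow> inverse (det s) ^ b \<noteq> inverse (det s) ^ a"
    using a_H_spec[OF G H, of chi] chi_e by (simp_all add: s_def a_def)
  have a': "chi s * det s = inverse (det s) ^ a'"
    "\<And>b. b < a' \<Longrightarrow> inverse (det s) ^ b \<noteq> inverse (det s) ^ a'"
    using a_H_spec[OF G H, of "\<lambda>g. chi g * det g"] chi_e e(1)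
    by (simp_all add: s_def a'_def power_mult_distrib)
  have dvd_H: "lin_poly l ^ a dvd contract (\<eta> i) v" if "lform l v = 0" for i v
  proof (rule semi_invariant_dvd[OF l(1) \<rho> sG(2) det_s _ a(2)])
    have "s *v v = v"
      using \<rho> that by (simp add: shear_def)
    then show "act s (contract (\<eta> i) v) = pconst (inverse (det s) ^ a) * contract (\<eta> i) v"
      using act_contract[OF \<eta> sG, of i v] by (simp add: a(1))
  qed
  \<comment> \<open>The eigenvalue \<open>det s\<close> of \<alpha> turns the character
    \<open>chi\<close> into \<open>chi\<close> times \<open>det\<close>.\<close>
  have dvd_\<alpha>: "lin_poly l ^ a' dvd contract (\<eta> i) \<alpha>" for i
  proof (rule semi_invariant_dvd[OF l(1) \<rho> sG(2) det_s _ a'(2)])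
    show "act s (contract (\<eta> i) \<alpha>) = pconst (inverse (det s) ^ a') * contract (\<eta> i) \<alpha>"
      using act_contract[OF \<eta> sG, of i \<alpha>]
      by (simp add: \<alpha>(2) contract_scale pconst_mult mult.assoc flip: a'(1))
  qed
  have dvd_root: "lin_poly l ^ ?e dvd contract (\<eta> i) \<beta>"
    if \<beta>: "\<beta> \<in> trans_roots G H" and chi_s: "chi s = 1" for i \<beta>
  proof -
    obtain t where t: "t \<in> G" "invertible t" "shear l \<beta> t" "lform l \<beta> = 0"
      using trans_roots_shear[OF G H \<beta>, folded l_def] by blast
    obtain h where h: "contract (\<eta> i) \<alpha> = lin_poly l ^ a' * h"
      using dvd_\<alpha>[of i] ..
    obtain r where r: "act t h - h = lin_poly l * r"
      using lin_poly_dvd_act_diff[OF t(3,2), of h] ..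
    have "act t (lin_poly l) = lin_poly l"
      using act_lin_poly_shear[OF t(3,2)] t(4) by simp
    then have "act t (contract (\<eta> i) \<alpha>) = lin_poly l ^ a' * act t h"
      by (simp add: h act_mult act_power)
    \<comment> \<open>The transvection moves \<alpha> by \<open>lform l \<alpha> *s \<beta>\<close>,
      and \<open>chi t = 1\<close>.\<close>
    moreover have "act t (contract (\<eta> i) \<alpha>) = contract (\<eta> i) \<alpha> + pconst (lform l \<alpha>) * contract (\<eta> i) \<beta>"
      using act_contract[OF \<eta> t(1,2), of i \<alpha>] chi_transvection[OF t(1,3) l(1) t(4)] t(3)
      by (simp add: shear_def contract_add contract_scale)
    ultimately have "pconst (lform l \<alpha>) * contract (\<eta> i) \<beta> = lin_poly l ^ a' * (act t h - h)"
      by (simp add: h right_diff_distrib eq_diff_eq add.commute)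
    also have "\<dots> = lin_poly l ^ Suc a' * r"
      by (simp add: r mult_ac)
    finally have "lin_poly l ^ Suc a' dvd contract (\<eta> i) \<beta>"
      using pconst_mult_dvd_iff[OF \<alpha>(1)] by (metis dvd_triv_left)
    \<comment> \<open>With \<open>chi s = 1\<close>, the definition of \<open>a'\<close> gives
      \<open>det s ^ Suc a' = 1\<close>, while \<open>det s\<close> has order
      \<open>?e\<close>.\<close>
    moreover have "?e \<le> Suc a'"
    proof -
      have "det s \<noteq> 0"
        using sG(2) invertible_det_nz by blast
      then have "det s ^ Suc a' = 1"
        using a'(1) chi_s by (simp add: power_inverse field_simps)
      then show ?thesis
        using e(2)[of "Suc a'"] by force
    qed
    ultimately show ?thesis
      by (meson dvd_trans le_imp_power_dvd)
  qed
  obtain B where B: "B \<subseteq> trans_roots G H" "vec.independent B" "card B = b_H G H"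
    unfolding b_H_def by (rule vec.basis_exists)
  have "B \<subseteq> {v. lform l v = 0}"
  proof
    fix \<beta> assume "\<beta> \<in> B"
    then show "\<beta> \<in> {v. lform l v = 0}"
      using trans_roots_shear[OF G H, of \<beta>, folded l_def] B(1) by blast
  qed
  then obtain v :: "'n \<Rightarrow> 'a ^ 'n" and k where v: "v k = \<alpha>" "\<And>j. j \<noteq> k \<Longrightarrow> lform l (v j) = 0"
      "inj v" "B \<subseteq> v ` (- {k})" and det: "det (\<chi> i j. v j $ i) \<noteq> 0"
    using B(2) \<alpha>(1) by (rule hyperplane_adapted_basis) blast
  \<comment> \<open>The exponent of \<open>l\<close> secured in column \<open>j\<close> of the
    matrix of contractions.\<close>
  define c where "c j = (if j = k then a' else if chi s = 1 \<and> v j \<in> B then ?e else a)" for j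
  have "lin_poly l ^ c j dvd contract (\<eta> i) (v j)" for i j
    using dvd_\<alpha> dvd_H v(1,2) dvd_root B(1) by (auto simp: c_def)
  then have "lin_poly l ^ (\<Sum>j\<in>UNIV. c j) dvd det (\<chi> i j. contract (\<eta> i) (v j))"
    by (intro det_dvd_of_columns) simp
  then have "lin_poly l ^ (\<Sum>j\<in>UNIV. c j) dvd pconst (det (\<chi> i j. v j $ i)) * top_wedge \<eta>"
    by (simp only: det_contract mult.commute)
  then have "lin_poly l ^ (\<Sum>j\<in>UNIV. c j) dvd top_wedge \<eta>"
    by (simp only: pconst_mult_dvd_iff[OF det])
  moreover have "(\<Sum>j\<in>UNIV. c j) = (if chi s = 1 then ?e * b_H G H else 0) + a * (CARD('n) - 1) + a'"
  proof -
    have "(\<Sum>j\<in>UNIV. c j) = a' + (\<Sum>j\<in>- {k}. if chi s = 1 \<and> v j \<in> B then ?e else a)"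
      by (simp add: sum.remove[of UNIV k] c_def Compl_eq_Diff_UNIV)
    also have "(\<Sum>j\<in>- {k}. if chi s = 1 \<and> v j \<in> B then ?e else a)
        = (if chi s = 1 then ?e * b_H G H else 0) + a * (CARD('n) - 1)"
    proof (cases "chi s = 1")
      case True
      \<comment> \<open>Columns other than those of \<alpha> and of the roots then contribute
        nothing, and the term with \<open>CARD('n) - 1\<close> vanishes.\<close>
      have "a = 0"
        using a True by (metis gr0I power_0)
      have "v ` {j \<in> - {k}. v j \<in> B} = B"
        using v(4) by auto
      then have "card {j \<in> - {k}. v j \<in> B} = card B"
        using card_image[of v "{j \<in> - {k}. v j \<in> B}"] v(3) by (metis inj_on_subset subset_UNIV)
      then show ?thesis
        using True \<open>a = 0\<close> B(3) by (simp add: sum.If_cases Int_def mult.commute)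
    next
      case False
      then show ?thesis
        by (simp add: Compl_eq_Diff_UNIV mult.commute)
    qed
    finally show ?thesis
      by simp
  qed
  ultimately show ?thesis
    by (simp add: l_def s_def a_def a'_def)
qed

end

section \<open>From single hyperplanes to the full product\<close>

lemma prod_hyperplanes_dvd_top_wedge:
  fixes G :: "('a::field ^ 'n ^ 'n::finite) set" and \<eta> :: "'n \<Rightarrow> ('a, 'n) form1"
  assumes G: "matrix_group G" and chi: "lin_char G chi" and \<eta>: "\<And>i. \<eta> i \<in> chi_forms G chi"
  shows "Q_tilde G chi * Q_char G chi ^ (CARD('n) - 1) * Q_char G (\<lambda>g. chi g * det g) dvd top_wedge \<eta>"
    and "Q_tilde G chi * Q_char G chi ^ (CARD('n) - 1) * Q_char G (\<lambda>g. chi g * det g) \<noteq> 0"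
proof -
  let ?R = "refl_hyperplanes G" and ?Q = "Q_tilde G chi * Q_char G chi ^ (CARD('n) - 1) * Q_char G (\<lambda>g. chi g * det g)"
  \<comment> \<open>Exponent 0 off the subset defining \<open>Q_tilde\<close>, so that all three
    products run over the same hyperplanes.\<close>
  define x where "x H = (if chi (s_H G H) = 1 then e_H G H * b_H G H else 0)" for H
  define k where "k H = x H + a_H G H chi * (CARD('n) - 1) + a_H G H (\<lambda>g. chi g * det g)" for H
  have "?R = fixspace ` {g \<in> G. is_reflection g}"
    by (auto simp: refl_hyperplanes_def)
  then have fin: "finite ?R"
    using G by (simp add: matrix_group_def)
  have hyp: "is_hyperplane H" if "H \<in> ?R" for H
    using that by (auto simp: refl_hyperplanes_def is_reflection_def)
  have "Q_tilde G chi = (\<Prod>H\<in>?R. lin_poly (def_form H) ^ x H)"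
    unfolding Q_tilde_def by (subst prod.inter_filter[OF fin]) (auto simp: x_def intro!: prod.cong)
  moreover have "Q_char G chi ^ (CARD('n) - 1) = (\<Prod>H\<in>?R. lin_poly (def_form H) ^ (a_H G H chi * (CARD('n) - 1)))"
    unfolding Q_char_def prod_power_distrib power_mult ..
  ultimately have Q: "?Q = (\<Prod>H\<in>?R. lin_poly (def_form H) ^ k H)"
    by (simp add: Q_char_def k_def power_add prod.distrib)
  show "?Q \<noteq> 0"
    unfolding Q
    by (intro mpoly_prod_nonzero mpoly_power_nonzero) (simp add: def_form_hyperplane(1) hyp)
  show "?Q dvd top_wedge \<eta>"
    unfolding Q
  proof (rule prod_lin_poly_power_dvd[OF fin])
    fix H H' assume H: "H \<in> ?R" "H' \<in> ?R" "lin_poly (def_form H) dvd lin_poly (def_form H')"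
    then show "H = H'"
      using lin_poly_dvd_lin_polyD[of "def_form H" "def_form H'"] def_form_hyperplane hyp by metis
  next
    fix H assume "H \<in> ?R"
    then show "lin_poly (def_form H) ^ k H dvd top_wedge \<eta>"
      unfolding k_def x_def by (intro lin_poly_power_dvd_top_wedge[OF G chi] hyp \<eta>)
  qed (simp add: def_form_hyperplane(1) hyp)
qed

section \<open>Cramer's rule and the basis property\<close>

theorem theorem7p3:
  fixes G :: "('a::field ^ 'n ^ 'n::finite) set"
    and chi :: "'a ^ 'n ^ 'n \<Rightarrow> 'a"
    and \<omega> :: "'n \<Rightarrow> ('a, 'n) form1"
    and c :: 'a
  assumes "(2::'a) \<noteq> 0"
    and "reflection_group G"
    and "lin_char G chi"
    and "\<forall>i. \<omega> i \<in> chi_forms G chi"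
    and "c \<noteq> 0"
    and "top_wedge \<omega> = pconst c * Q_tilde G chi * Q_char G chi ^ (CARD('n) - 1)
                        * Q_char G (\<lambda>g. chi g * det g)"
  shows "\<forall>\<eta>\<in>chi_forms G chi. \<exists>!f. (\<forall>i. f i \<in> invariants G)
                                 \<and> \<eta> = (\<lambda>j. \<Sum>i\<in>UNIV. f i * \<omega> i j)"
proof
  fix \<eta> assume \<eta>: "\<eta> \<in> chi_forms G chi"
  have G: "matrix_group G"
    using assms(2) by (simp add: reflection_group_def)
  define Q where "Q = Q_tilde G chi * Q_char G chi ^ (CARD('n) - 1) * Q_char G (\<lambda>g. chi g * det g)"
  define D where "D = top_wedge \<omega>"
  have DQ: "D = pconst c * Q"
    unfolding D_def Q_def assms(6) by (simp only: mult.assoc)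
  have Q: "Q \<noteq> 0"
    using prod_hyperplanes_dvd_top_wedge(2)[OF G assms(3), of \<omega>] assms(4) by (simp add: Q_def)
  have D: "D \<noteq> 0"
    using mpoly_no_zero_divisors[of "pconst c" Q] Q assms(5) by (auto simp: DQ)
  \<comment> \<open>The numerators of Cramer's rule; the coefficients will be \<open>W k\<close>
    divided by \<open>D\<close>.\<close>
  define W where "W k = top_wedge (fun_upd \<omega> k \<eta>)" for k
  have forms: "fun_upd \<omega> k \<eta> i \<in> chi_forms G chi" for k i
    using \<eta> assms(4) by simp
  have "\<exists>f. W k = D * f" for k
  proof -
    have "Q dvd W k"
      unfolding Q_def W_def by (intro prod_hyperplanes_dvd_top_wedge(1)[OF G assms(3)] forms)
    then obtain q where q: "W k = Q * q" ..
    have "W k = D * (pconst (inverse c) * q)"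
    proof -
      have "D * (pconst (inverse c) * q) = (pconst c * pconst (inverse c)) * (Q * q)"
        by (simp only: DQ mult_ac)
      then show ?thesis
        by (simp only: pconst_inverse[OF assms(5)] q mult_1)
    qed
    then show ?thesis ..
  qed
  then obtain f where f: "\<And>k. W k = D * f k"
    by metis
  define A :: "('a, 'n) mpoly ^ 'n ^ 'n" where "A = (\<chi> k j. \<omega> k j)"
  have det_A: "det A = D"
    by (simp add: A_def D_def top_wedge_def)
  have W: "W k = (\<Sum>j\<in>UNIV. \<eta> j * cofactors A $ j $ k)" for k
  proof -
    have "W k = det (\<chi> i. if i = k then (\<chi> j. \<eta> j) else A $ i)"
      unfolding W_def top_wedge_def by (rule arg_cong[of _ _ det]) (simp add: vec_eq_iff A_def)
    then show ?thesis
      by (simp add: det_replace_row)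
  qed
  \<comment> \<open>Numerator and denominator acquire the same factor under
    \<open>g\<close>.\<close>
  have inv: "f k \<in> invariants G" for k
    unfolding invariants_def
  proof (intro CollectI ballI)
    fix g assume g: "g \<in> G"
    let ?x = "pconst (chi g) ^ CARD('n) :: ('a, 'n) mpoly" and ?d = "pconst (det (matrix_inv g))"
    have 1: "act g (W k) * ?d = ?x * W k"
      unfolding W_def by (rule act_top_wedge[OF _ g]) (rule forms)
    have 2: "act g D * ?d = ?x * D"
      unfolding D_def using assms(4) g by (intro act_top_wedge) auto
    have "(?x * D) * act g (f k) = act g (W k) * ?d"
      unfolding 2[symmetric] f act_mult by (simp only: mult_ac)
    also have "\<dots> = (?x * D) * f k"
      unfolding 1 unfolding f by (simp only: mult_ac)
    finally have "(?x * D) * act g (f k) = (?x * D) * f k" .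
    moreover have "?x * D \<noteq> 0"
    proof -
      have "chi g \<noteq> 0"
        using assms(3) g by (simp add: lin_char_def)
      then have "?x \<noteq> 0"
        by (intro mpoly_power_nonzero) simp
      then show ?thesis
        using D mpoly_no_zero_divisors by blast
    qed
    ultimately show "act g (f k) = f k"
      using mpoly_mult_cancel by blast
  qed
  have comb: "\<eta> = (\<lambda>j. \<Sum>i\<in>UNIV. f i * \<omega> i j)"
  proof
    fix i
    have "D * (\<Sum>k\<in>UNIV. f k * \<omega> k i) = (\<Sum>k\<in>UNIV. W k * A $ k $ i)"
      by (simp add: f A_def sum_distrib_left mult.assoc)
    also have "\<dots> = (\<Sum>k\<in>UNIV. \<Sum>j\<in>UNIV. \<eta> j * (cofactors A $ j $ k * A $ k $ i))"
      by (simp add: W sum_distrib_right mult.assoc)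
    also have "\<dots> = (\<Sum>j\<in>UNIV. \<eta> j * (cofactors A ** A) $ j $ i)"
      by (subst sum.swap) (simp add: matrix_matrix_mult_def sum_distrib_left)
    also have "\<dots> = (\<Sum>j\<in>UNIV. if j = i then D * \<eta> i else 0)"
      using cofactors_matrix_mult[of A] D by (intro sum.cong refl) (simp add: det_A mat_def mult.commute)
    also have "\<dots> = D * \<eta> i"
      by simp
    finally show "\<eta> i = (\<Sum>k\<in>UNIV. f k * \<omega> k i)"
      using mpoly_mult_cancel[OF D] by metis
  qed
  \<comment> \<open>Existence used the adjugate on the left of \<open>A\<close>; with the adjugate
    on the right, any expansion of \<eta> yields Cramer's formula.\<close>
  have uniq: "D * h k = W k" if h: "\<eta> = (\<lambda>j. \<Sum>i\<in>UNIV. h i * \<omega> i j)" for h k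
  proof -
    have "W k = (\<Sum>j\<in>UNIV. \<Sum>i\<in>UNIV. h i * (A $ i $ j * cofactors A $ j $ k))"
      unfolding W by (subst h) (simp add: A_def sum_distrib_right mult.assoc)
    also have "\<dots> = (\<Sum>i\<in>UNIV. h i * (A ** cofactors A) $ i $ k)"
      by (subst sum.swap) (simp add: matrix_matrix_mult_def sum_distrib_left)
    also have "\<dots> = (\<Sum>i\<in>UNIV. if i = k then D * h k else 0)"
      by (intro sum.cong refl) (simp add: matrix_mult_cofactors det_A mat_def mult.commute)
    finally show ?thesis
      by simp
  qed
  show "\<exists>!f. (\<forall>i. f i \<in> invariants G) \<and> \<eta> = (\<lambda>j. \<Sum>i\<in>UNIV. f i * \<omega> i j)"
  proof (rule ex1I[of _ f])
    show "(\<forall>i. f i \<in> invariants G) \<and> \<eta> = (\<lambda>j. \<Sum>i\<in>UNIV. f i * \<omega> i j)"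
      using inv comb by blast
  next
    fix h assume "(\<forall>i. h i \<in> invariants G) \<and> \<eta> = (\<lambda>j. \<Sum>i\<in>UNIV. h i * \<omega> i j)"
    then have "D * h k = D * f k" for k
      using uniq[of h k] f by simp
    then show "h = f"
      using mpoly_mult_cancel[OF D] by blast
  qed
qed

end
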